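(* Let $\mathcal{M}^4=\mathbb{R}^4$ with standard coordinates $(x_1,x_2,x_3,x_4)$, equipped with the Riemannian metric $$g=\varphi^1\otimes\varphi^1+\varphi^2\otimes\varphi^2+\varphi^3\otimes\varphi^3+\varphi^4\otimes\varphi^4,$$ where $\varphi^1=dx_1$, $\varphi^2=dx_2-x_1dx_4$, $\varphi^3=dx_3-x_2dx_4$, $\varphi^4=dx_4$. Let $$X=-2x_1\frac{\partial}{\partial x_1}-3x_2\frac{\partial}{\partial x_2}-4x_3\frac{\partial}{\partial x_3}-x_4\frac{\partial}{\partial x_4},$$ and let $\alpha=3$ (the paper's $\mathrm{nil}^4$ soliton $(\mathcal{M}^4,g,X,3)$). Let $$Lh=\Delta_\ell h-\mathcal{L}_X h-3h$$ be the linearization at $(\mathcal{M}^4,g,X,3)$ of the modified Ricci flow $\frac{\partial}{\partial\tau}g=-2\operatorname{Rc}(g)-\mathcal{L}_Xg-3g$. Then this linearization is strictly linearly stable, in the sense that there exists a constant $\omega>0.0057$ such that for every smooth compactly supported real symmetric $(2,0)$-tensor field $h$ on $\mathcal{M}^4$, $$\int_{\mathcal{M}^4}\langle Lh,h\rangle\,d\mu\le-\|\nabla h\|^2-\omega\|h\|^2.$$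
   Context: A $(2,0)$-tensor field is a covariant 2-tensor field $h=h_{ij}$. $\nabla$ is the Levi-Civita connection of $g$, $d\mu$ its volume measure, $\langle\cdot,\cdot\rangle$ the pointwise inner product on tensors induced by $g$ (so $|h|^2=g^{ik}g^{jl}h_{ij}h_{kl}$), and $\|\cdot\|$ the $L^2$ norm with respect to $d\mu$. $\mathcal{L}_X$ is the Lie derivative. $\Delta_\ell$ is the Lichnerowicz Laplacian $$\Delta_\ell h_{ij}=\Delta h_{ij}+2R_{ipqj}h^{pq}-R_i^kh_{kj}-R_j^kh_{ik},$$ where $\Delta=g^{ij}\nabla_i\nabla_j$ is the rough Laplacian, $R_{ij}$ is the Ricci tensor, and the sign convention for $R_{ijkl}$ is that $R_{ijji}$ is the sectional curvature of the plane spanned by orthonormal vectors $e_i,e_j$. The linearization is taken after the DeTurck modification (the vector field is varied together with the metric so as to make the linearized operator elliptic), which gives exactly the operator $L$ displayed in the claim; this operator is what the claim is about. *)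

theory Defs
  imports "HOL-Analysis.Analysis"
begin

text \<open>
  Tensor calculus on \<open>\<real>\<^sup>n\<close> in the standard global coordinates. A covariant 2-tensor field \<open>h\<close> is
  given by its component matrices, \<open>h\<^sub>i\<^sub>j(x) = h x $ i $ j\<close>; a vector field by its components
  \<open>X\<^sup>k(x) = X x $ k\<close>.
\<close>

type_synonym 'n vector_field = "real ^ 'n \<Rightarrow> real ^ 'n"
type_synonym 'n tensor2_field = "real ^ 'n \<Rightarrow> real ^ 'n ^ 'n"
type_synonym 'n tensor3_field = "real ^ 'n \<Rightarrow> 'n \<Rightarrow> 'n \<Rightarrow> 'n \<Rightarrow> real"
type_synonym 'n tensor4_field = "real ^ 'n \<Rightarrow> 'n \<Rightarrow> 'n \<Rightarrow> 'n \<Rightarrow> 'n \<Rightarrow> real"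

definition partial :: "'n::finite \<Rightarrow> (real ^ 'n \<Rightarrow> real) \<Rightarrow> real ^ 'n \<Rightarrow> real" where
  "partial i f x = frechet_derivative f (at x) (axis i 1)"

text \<open>
  Iterated partial derivatives of every order being Frechet differentiable everywhere (hence
  continuous) is the usual notion of \<open>C\<^sup>\<infinity>\<close>.
\<close>

definition smooth :: "(real ^ 'n::finite \<Rightarrow> real) \<Rightarrow> bool" where
  "smooth f \<longleftrightarrow> (\<forall>is :: 'n list. \<forall>x. foldr partial is f differentiable (at x))"

definition smooth_tensor2 :: "'n::finite tensor2_field \<Rightarrow> bool" where
  "smooth_tensor2 h \<longleftrightarrow> (\<forall>i j. smooth (\<lambda>x. h x $ i $ j))"

definition symmetric_tensor2 :: "'n::finite tensor2_field \<Rightarrow> bool" where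
  "symmetric_tensor2 h \<longleftrightarrow> (\<forall>x. transpose (h x) = h x)"

definition compactly_supported :: "'n::finite tensor2_field \<Rightarrow> bool" where
  "compactly_supported h \<longleftrightarrow> compact (closure {x. h x \<noteq> 0})"

definition ginv :: "'n::finite tensor2_field \<Rightarrow> real ^ 'n \<Rightarrow> 'n \<Rightarrow> 'n \<Rightarrow> real" where
  "ginv g x i j = matrix_inv (g x) $ i $ j"

text \<open>\<open>christoffel g x k i j\<close> is \<open>\<Gamma>\<^sup>k\<^sub>i\<^sub>j\<close>, the Levi-Civita connection of \<open>g\<close>.\<close>

definition christoffel :: "'n::finite tensor2_field \<Rightarrow> 'n tensor3_field" where
  "christoffel g x k i j =
     (\<Sum>l\<in>UNIV. ginv g x k l *
        (partial i (\<lambda>y. g y $ j $ l) x + partial j (\<lambda>y. g y $ i $ l) x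
          - partial l (\<lambda>y. g y $ i $ j) x)) / 2"

text \<open>
  The differentiation index comes first: \<open>cov_deriv2 g h x k i j\<close> is \<open>\<nabla>\<^sub>k h\<^sub>i\<^sub>j\<close>, and
  \<open>cov_deriv3 g T x l k i j\<close> is \<open>\<nabla>\<^sub>l T\<^sub>k\<^sub>i\<^sub>j\<close>.
\<close>

definition cov_deriv2 :: "'n::finite tensor2_field \<Rightarrow> 'n tensor2_field \<Rightarrow> 'n tensor3_field" where
  "cov_deriv2 g h x k i j =
     partial k (\<lambda>y. h y $ i $ j) x
     - (\<Sum>m\<in>UNIV. christoffel g x m k i * h x $ m $ j)
     - (\<Sum>m\<in>UNIV. christoffel g x m k j * h x $ i $ m)"

definition cov_deriv3 :: "'n::finite tensor2_field \<Rightarrow> 'n tensor3_field \<Rightarrow> 'n tensor4_field" where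
  "cov_deriv3 g T x l k i j =
     partial l (\<lambda>y. T y k i j) x
     - (\<Sum>m\<in>UNIV. christoffel g x m l k * T x m i j)
     - (\<Sum>m\<in>UNIV. christoffel g x m l i * T x k m j)
     - (\<Sum>m\<in>UNIV. christoffel g x m l j * T x k i m)"

definition rough_laplacian :: "'n::finite tensor2_field \<Rightarrow> 'n tensor2_field \<Rightarrow> 'n tensor2_field" where
  "rough_laplacian g h x =
     (\<chi> i j. \<Sum>l\<in>UNIV. \<Sum>k\<in>UNIV. ginv g x l k * cov_deriv3 g (cov_deriv2 g h) x l k i j)"

text \<open>
  \<open>curvature_endo g x i j k l\<close> is the \<open>l\<close>-th component of
  \<open>R(\<partial>\<^sub>i,\<partial>\<^sub>j)\<partial>\<^sub>k = \<nabla>\<^sub>i\<nabla>\<^sub>j\<partial>\<^sub>k - \<nabla>\<^sub>j\<nabla>\<^sub>i\<partial>\<^sub>k\<close>, and \<open>R\<^sub>i\<^sub>j\<^sub>k\<^sub>l = \<langle>R(\<partial>\<^sub>i,\<partial>\<^sub>j)\<partial>\<^sub>k,\<partial>\<^sub>l\<rangle>\<close>, so that \<open>R\<^sub>i\<^sub>j\<^sub>j\<^sub>i\<close> is a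
  sectional curvature for orthonormal vectors.
\<close>

definition curvature_endo :: "'n::finite tensor2_field \<Rightarrow> 'n tensor4_field" where
  "curvature_endo g x i j k l =
     partial i (\<lambda>y. christoffel g y l j k) x - partial j (\<lambda>y. christoffel g y l i k) x
     + (\<Sum>m\<in>UNIV. christoffel g x m j k * christoffel g x l i m
                - christoffel g x m i k * christoffel g x l j m)"

definition riemann :: "'n::finite tensor2_field \<Rightarrow> 'n tensor4_field" where
  "riemann g x i j k l = (\<Sum>m\<in>UNIV. curvature_endo g x i j k m * g x $ m $ l)"

definition ricci :: "'n::finite tensor2_field \<Rightarrow> 'n tensor2_field" where
  "ricci g x = (\<chi> i j. \<Sum>p\<in>UNIV. \<Sum>q\<in>UNIV. ginv g x p q * riemann g x p i j q)"

text \<open>\<open>raise_both g h x p q\<close> is \<open>h\<^sup>p\<^sup>q\<close>, and \<open>raise_second g h x i k\<close> is \<open>h\<^sub>i\<^sup>k\<close>.\<close>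

definition raise_both ::
  "'n::finite tensor2_field \<Rightarrow> 'n tensor2_field \<Rightarrow> real ^ 'n \<Rightarrow> 'n \<Rightarrow> 'n \<Rightarrow> real" where
  "raise_both g h x p q = (\<Sum>a\<in>UNIV. \<Sum>b\<in>UNIV. ginv g x p a * ginv g x q b * h x $ a $ b)"

definition raise_second ::
  "'n::finite tensor2_field \<Rightarrow> 'n tensor2_field \<Rightarrow> real ^ 'n \<Rightarrow> 'n \<Rightarrow> 'n \<Rightarrow> real" where
  "raise_second g h x i k = (\<Sum>a\<in>UNIV. ginv g x k a * h x $ i $ a)"

definition lichnerowicz :: "'n::finite tensor2_field \<Rightarrow> 'n tensor2_field \<Rightarrow> 'n tensor2_field" where
  "lichnerowicz g h x =
     (\<chi> i j. rough_laplacian g h x $ i $ j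
        + 2 * (\<Sum>p\<in>UNIV. \<Sum>q\<in>UNIV. riemann g x i p q j * raise_both g h x p q)
        - (\<Sum>k\<in>UNIV. raise_second g (ricci g) x i k * h x $ k $ j)
        - (\<Sum>k\<in>UNIV. raise_second g (ricci g) x j k * h x $ i $ k))"

definition lie_deriv2 :: "'n::finite vector_field \<Rightarrow> 'n tensor2_field \<Rightarrow> 'n tensor2_field" where
  "lie_deriv2 X h x =
     (\<chi> i j. \<Sum>k\<in>UNIV. X x $ k * partial k (\<lambda>y. h y $ i $ j) x
        + h x $ k $ j * partial i (\<lambda>y. X y $ k) x
        + h x $ i $ k * partial j (\<lambda>y. X y $ k) x)"

text \<open>
  The linearization at \<open>(g, X, \<alpha>)\<close>, after the DeTurck modification, of the flow
  \<open>\<partial>\<^sub>\<tau> g = -2 Rc(g) - \<L>\<^sub>X g - \<alpha> g\<close>.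
\<close>

definition flow_linearization ::
  "'n::finite tensor2_field \<Rightarrow> 'n vector_field \<Rightarrow> real \<Rightarrow> 'n tensor2_field \<Rightarrow> 'n tensor2_field" where
  "flow_linearization g X \<alpha> h x = lichnerowicz g h x - lie_deriv2 X h x - \<alpha> *\<^sub>R h x"

definition inner2 ::
  "'n::finite tensor2_field \<Rightarrow> 'n tensor2_field \<Rightarrow> 'n tensor2_field \<Rightarrow> real ^ 'n \<Rightarrow> real" where
  "inner2 g h h' x =
     (\<Sum>i\<in>UNIV. \<Sum>j\<in>UNIV. \<Sum>k\<in>UNIV. \<Sum>l\<in>UNIV.
        ginv g x i k * ginv g x j l * h x $ i $ j * h' x $ k $ l)"

definition inner3 ::
  "'n::finite tensor2_field \<Rightarrow> 'n tensor3_field \<Rightarrow> 'n tensor3_field \<Rightarrow> real ^ 'n \<Rightarrow> real" where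
  "inner3 g T T' x =
     (\<Sum>i\<in>UNIV. \<Sum>j\<in>UNIV. \<Sum>k\<in>UNIV. \<Sum>a\<in>UNIV. \<Sum>b\<in>UNIV. \<Sum>c\<in>UNIV.
        ginv g x i a * ginv g x j b * ginv g x k c * T x i j k * T' x a b c)"

definition vol :: "'n::finite tensor2_field \<Rightarrow> (real ^ 'n) measure" where
  "vol g = density lborel (\<lambda>x. ennreal (sqrt (det (g x))))"

definition L2_norm2 :: "'n::finite tensor2_field \<Rightarrow> 'n tensor2_field \<Rightarrow> real" where
  "L2_norm2 g h = sqrt (LINT x|vol g. inner2 g h h x)"

definition L2_norm3 :: "'n::finite tensor2_field \<Rightarrow> 'n tensor3_field \<Rightarrow> real" where
  "L2_norm3 g T = sqrt (LINT x|vol g. inner3 g T T x)"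

abbreviation dx :: "4 \<Rightarrow> real ^ 4" where
  "dx i \<equiv> axis i 1"

definition nil4_coframe :: "real ^ 4 \<Rightarrow> real ^ 4 ^ 4" where
  "nil4_coframe x =
     vector [dx 1, dx 2 - x $ 1 *\<^sub>R dx 4, dx 3 - x $ 2 *\<^sub>R dx 4, dx 4]"

definition tensor_prod :: "real ^ 'n::finite \<Rightarrow> real ^ 'n \<Rightarrow> real ^ 'n ^ 'n" where
  "tensor_prod \<phi> \<psi> = (\<chi> i j. \<phi> $ i * \<psi> $ j)"

definition nil4_metric :: "4 tensor2_field" where
  "nil4_metric x = (\<Sum>a\<in>UNIV. tensor_prod (nil4_coframe x $ a) (nil4_coframe x $ a))"

definition nil4_field :: "4 vector_field" where
  "nil4_field x = vector [- 2 * x $ 1, - 3 * x $ 2, - 4 * x $ 3, - x $ 4]"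

end

theory Submission
  imports Defs
begin

text \<open>
  In the frame \<open>e\<^sub>1 = \<partial>\<^sub>1\<close>, \<open>e\<^sub>2 = \<partial>\<^sub>2\<close>, \<open>e\<^sub>3 = \<partial>\<^sub>3\<close>, \<open>e\<^sub>4 = \<partial>\<^sub>4 + x\<^sub>1 \<partial>\<^sub>2 + x\<^sub>2 \<partial>\<^sub>3\<close> dual to the \<open>\<phi>\<^sup>a\<close>, the
  connection and curvature coefficients are constant, and \<open>\<L>\<^sub>X e\<^sub>a = \<lambda>\<^sub>a e\<^sub>a\<close> with
  \<open>\<lambda> = (2, 3, 4, 1)\<close>. The volume measure is Lebesgue measure and \<open>div X = -10\<close>. Integrating by parts,
  \<open>\<integral>\<langle>\<Delta>h, h\<rangle> = -\<parallel>\<nabla>h\<parallel>\<^sup>2\<close> and \<open>-\<integral>\<langle>X h, h\<rangle> = -5 \<parallel>h\<parallel>\<^sup>2\<close>, where \<open>X\<close> differentiates the frame components.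
  What remains is a pointwise inequality for a quadratic form with constant coefficients in the ten
  frame components of \<open>h\<close>, proved by completing squares; it gives \<open>\<omega> = 1/5\<close>.
\<close>

section \<open>Smooth functions and partial derivatives\<close>

lemma partial_eqI: "(f has_derivative f') (at x) \<Longrightarrow> partial i f x = f' (axis i 1)"
  unfolding partial_def by (metis frechet_derivative_at)

lemma partial_const [simp]: "partial i (\<lambda>_. c) x = 0"
  by (rule partial_eqI) (auto intro: derivative_eq_intros)

lemma partial_coord [simp]: "partial i (\<lambda>y. y $ j) x = (if i = j then 1 else 0)"
  by (subst partial_eqI[where f' = "\<lambda>v. v $ j"])
    (auto intro!: bounded_linear_imp_has_derivative bounded_linear_vec_nth simp: axis_def)

lemma partial_add:
  assumes "f differentiable (at x)" "g differentiable (at x)"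
  shows "partial i (\<lambda>y. f y + g y) x = partial i f x + partial i g x"
  using assms unfolding frechet_derivative_works
  by (subst partial_eqI[OF has_derivative_add]) (auto simp: partial_def)

lemma partial_minus:
  assumes "f differentiable (at x)"
  shows "partial i (\<lambda>y. - f y) x = - partial i f x"
  using assms unfolding frechet_derivative_works
  by (subst partial_eqI[OF has_derivative_minus]) (auto simp: partial_def)

lemma partial_diff:
  assumes "f differentiable (at x)" "g differentiable (at x)"
  shows "partial i (\<lambda>y. f y - g y) x = partial i f x - partial i g x"
  using assms unfolding frechet_derivative_works
  by (subst partial_eqI[OF has_derivative_diff]) (auto simp: partial_def)

lemma partial_mult:
  assumes "f differentiable (at x)" "g differentiable (at x)"
  shows "partial i (\<lambda>y. f y * g y) x = partial i f x * g x + f x * partial i g x"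
  using assms unfolding frechet_derivative_works
  by (subst partial_eqI[OF has_derivative_mult]) (auto simp: partial_def)

lemma partial_divide:
  assumes "f differentiable (at x)"
  shows "partial i (\<lambda>y. f y / c) x = partial i f x / c"
  using partial_mult[OF assms, of "\<lambda>_. inverse c"] by (simp add: divide_inverse)

lemma partial_sum:
  assumes "\<And>a. a \<in> S \<Longrightarrow> f a differentiable (at x)"
  shows "partial i (\<lambda>y. \<Sum>a\<in>S. f a y) x = (\<Sum>a\<in>S. partial i (f a) x)"
  using assms unfolding frechet_derivative_works
  by (subst partial_eqI[OF has_derivative_sum]) (auto simp: partial_def)

text \<open>Finite-order smoothness by recursion on the order. Each level exposes the innermost
  derivative \<open>partial i f\<close>, so sum and product rules follow by induction on
  \<open>n\<close> with the functions left arbitrary; the list formulation in \<open>smooth\<close>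
  offers no such induction.\<close>

fun smooth_upto :: "nat \<Rightarrow> (real ^ 'n::finite \<Rightarrow> real) \<Rightarrow> bool" where
  "smooth_upto 0 f \<longleftrightarrow> (\<forall>x. f differentiable (at x))"
| "smooth_upto (Suc n) f \<longleftrightarrow> (\<forall>x. f differentiable (at x)) \<and> (\<forall>i. smooth_upto n (partial i f))"

lemma smooth_upto_iff:
  "smooth_upto n f \<longleftrightarrow> (\<forall>is x. length is \<le> n \<longrightarrow> foldr partial is f differentiable (at x))"
proof (induction n arbitrary: f)
  case (Suc n)
  have "(\<forall>is x. length is \<le> Suc n \<longrightarrow> foldr partial is f differentiable (at x)) \<longleftrightarrow>
    (\<forall>x. f differentiable (at x)) \<and>
    (\<forall>i is x. length is \<le> n \<longrightarrow> foldr partial is (partial i f) differentiable (at x))"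
    (is "?L \<longleftrightarrow> ?R")
  proof
    assume L: ?L
    show ?R
    proof (intro conjI allI impI)
      show "f differentiable (at x)" for x using L[rule_format, of "[]" x] by simp
      \<comment> \<open>\<open>foldr\<close> applies the last list element first, so the innermost
        derivative is split off at the end of the list, here by \<open>is @ [i]\<close> and below by
        \<open>rev_cases\<close>.\<close>
      show "foldr partial is (partial i f) differentiable (at x)" if "length is \<le> n" for i "is" x
        using L[rule_format, of "is @ [i]" x] that by simp
    qed
  next
    assume R: ?R
    show ?L
    proof (intro allI impI)
      fix js :: "'a list" and x assume "length js \<le> Suc n"
      then show "foldr partial js f differentiable (at x)"
        using R by (cases js rule: rev_cases) auto
    qed
  qed
  then show ?case by (simp add: Suc.IH)
qed simp

lemma smooth_iff_smooth_upto: "smooth f \<longleftrightarrow> (\<forall>n. smooth_upto n f)"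
  unfolding smooth_def smooth_upto_iff by auto

lemma smooth_upto_differentiable: "smooth_upto n f \<Longrightarrow> f differentiable (at x)"
  by (cases n) auto

lemma smooth_upto_SucD: "smooth_upto (Suc n) f \<Longrightarrow> smooth_upto n f"
  by (simp add: smooth_upto_iff)

lemma smooth_differentiable: "smooth f \<Longrightarrow> f differentiable (at x)"
  by (metis smooth_iff_smooth_upto smooth_upto_differentiable)

lemma smooth_partial [intro]: "smooth f \<Longrightarrow> smooth (partial i f)"
  unfolding smooth_iff_smooth_upto by (meson smooth_upto.simps(2))

lemma smooth_upto_const: "smooth_upto n (\<lambda>_ :: real ^ 'n::finite. c)"
proof (induction n arbitrary: c)
  case (Suc n)
  have "partial i (\<lambda>_. c) = (\<lambda>_. 0)" for i :: 'n by auto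
  with Suc show ?case by simp
qed simp

lemma smooth_upto_add: "smooth_upto n f \<Longrightarrow> smooth_upto n g \<Longrightarrow> smooth_upto n (\<lambda>y. f y + g y)"
proof (induction n arbitrary: f g)
  case (Suc n)
  have "partial i (\<lambda>y. f y + g y) = (\<lambda>x. partial i f x + partial i g x)" for i
    using Suc.prems by (auto simp: partial_add)
  with Suc show ?case by simp
qed simp

lemma smooth_upto_mult: "smooth_upto n f \<Longrightarrow> smooth_upto n g \<Longrightarrow> smooth_upto n (\<lambda>y. f y * g y)"
proof (induction n arbitrary: f g)
  case (Suc n)
  have "partial i (\<lambda>y. f y * g y) = (\<lambda>x. partial i f x * g x + f x * partial i g x)" for i
    using Suc.prems by (auto simp: partial_mult)
  \<comment> \<open>The Leibniz rule pairs a derivative with an undifferentiated factor, so both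
    factors are also needed at the lower order.\<close>
  moreover have "smooth_upto n f" "smooth_upto n g" using Suc.prems by (blast dest: smooth_upto_SucD)+
  ultimately show ?case using Suc by (auto intro!: smooth_upto_add)
qed simp

lemma smooth_const [intro, simp]: "smooth (\<lambda>_. c)"
  by (simp add: smooth_iff_smooth_upto smooth_upto_const)

lemma smooth_coord [intro, simp]: "smooth (\<lambda>y. y $ j)"
proof -
  have "smooth_upto n (\<lambda>y. y $ j)" for n
  proof (cases n)
    case (Suc m)
    have "partial i (\<lambda>y. y $ j) = (\<lambda>_. if i = j then 1 else 0)" for i by auto
    with Suc show ?thesis
      by (auto simp: smooth_upto_const intro!: linear_imp_differentiable bounded_linear.linear bounded_linear_vec_nth)
  qed (auto intro!: linear_imp_differentiable bounded_linear.linear bounded_linear_vec_nth)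
  then show ?thesis by (simp add: smooth_iff_smooth_upto)
qed

lemma smooth_add [intro]: "smooth f \<Longrightarrow> smooth g \<Longrightarrow> smooth (\<lambda>y. f y + g y)"
  by (simp add: smooth_iff_smooth_upto smooth_upto_add)

lemma smooth_mult [intro]: "smooth f \<Longrightarrow> smooth g \<Longrightarrow> smooth (\<lambda>y. f y * g y)"
  by (simp add: smooth_iff_smooth_upto smooth_upto_mult)

lemma smooth_minus [intro]: "smooth f \<Longrightarrow> smooth (\<lambda>y. - f y)"
  using smooth_mult[of "\<lambda>_. -1" f] by simp

lemma smooth_diff [intro]: "smooth f \<Longrightarrow> smooth g \<Longrightarrow> smooth (\<lambda>y. f y - g y)"
  using smooth_add[OF _ smooth_minus, of f g] by simp

lemma smooth_divide [intro]: "smooth f \<Longrightarrow> smooth (\<lambda>y. f y / c)"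
  using smooth_mult[of f "\<lambda>_. inverse c"] by (simp add: divide_inverse)

lemma smooth_sum [intro]: "(\<And>a. a \<in> S \<Longrightarrow> smooth (f a)) \<Longrightarrow> smooth (\<lambda>y. \<Sum>a\<in>S. f a y)"
  by (induction S rule: infinite_finite_induct) auto

lemma smooth_continuous: "smooth f \<Longrightarrow> continuous_on S f"
  by (meson continuous_at_imp_continuous_on differentiable_imp_continuous_within smooth_differentiable)

section \<open>Integration by parts\<close>

text \<open>The complement of \<open>K\<close> is open, so \<open>f\<close> agrees with the zero
  function near \<open>x\<close>.\<close>

lemma partial_eq_0_outside:
  assumes "closed K" "\<And>x. x \<notin> K \<Longrightarrow> f x = 0" "x \<notin> K"
  shows "partial i f x = 0"
proof -
  have "(f has_derivative (\<lambda>_. 0)) (at x)"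
    by (rule has_derivative_transform_within_open[where s = "- K" and f = "\<lambda>_. 0"])
      (use assms in auto)
  then show ?thesis by (rule partial_eqI)
qed

lemma integrable_compact_support:
  fixes f :: "real ^ 'n::finite \<Rightarrow> real"
  assumes "continuous_on UNIV f" "compact K" "\<And>x. x \<notin> K \<Longrightarrow> f x = 0"
  shows "integrable lborel f"
proof -
  have "set_integrable lborel K f"
    unfolding set_integrable_def
    using borel_integrable_compact[OF assms(2) continuous_on_subset[OF assms(1) subset_UNIV]]
    by (simp add: indicator_scaleR_eq_if)
  moreover have "(\<lambda>x. indicat_real K x *\<^sub>R f x) = f"
    by (intro ext) (auto simp: assms(3) indicator_def)
  ultimately show ?thesis by (simp add: set_integrable_def)
qed

lemma lborel_integral_translate:
  fixes f :: "'a::euclidean_space \<Rightarrow> real"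
  assumes "f \<in> borel_measurable borel"
  shows "(LINT x|lborel. f (a + x)) = (LINT x|lborel. f x)"
  using integral_distr[of "(+) a" lborel borel f] assms by (simp add: lborel_distr_plus)

text \<open>
  The difference quotients of \<open>f\<close> in a coordinate direction have integral zero by translation
  invariance, and converge dominatedly to the partial derivative.
\<close>

lemma integral_partial_eq_0:
  fixes f :: "real ^ 'n::finite \<Rightarrow> real"
  assumes f: "smooth f" and K: "compact K" "\<And>x. x \<notin> K \<Longrightarrow> f x = 0"
  shows "(LINT x|lborel. partial i f x) = 0"
proof -
  define e :: "real ^ 'n" where "e = axis i 1"
  define q where "q n x = real (Suc n) * (f ((1 / real (Suc n)) *\<^sub>R e + x) - f x)" for n x
  define d where "d = partial i f"
  have deriv: "((\<lambda>t. f (x + t *\<^sub>R e)) has_real_derivative d (x + t *\<^sub>R e)) (at t)" for x t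
  proof -
    have fd: "(f has_derivative frechet_derivative f (at (x + t *\<^sub>R e))) (at (x + t *\<^sub>R e))"
      using smooth_differentiable[OF f] frechet_derivative_works by blast
    have "((\<lambda>t. f (x + t *\<^sub>R e)) has_derivative
        (\<lambda>s. frechet_derivative f (at (x + t *\<^sub>R e)) (s *\<^sub>R e))) (at t)"
      by (rule has_derivative_compose[where f = "\<lambda>t. x + t *\<^sub>R e" and g = f])
        (use fd in \<open>auto intro!: derivative_eq_intros\<close>)
    moreover have "frechet_derivative f (at (x + t *\<^sub>R e)) (s *\<^sub>R e) = d (x + t *\<^sub>R e) * s" for s
      using linear_cmul[OF has_derivative_linear[OF fd]]
      by (simp add: d_def partial_def e_def)
    ultimately show ?thesis by (simp add: has_field_derivative_def)
  qed
  have d: "smooth d" unfolding d_def using f by auto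
  have d0: "d x = 0" if "x \<notin> K" for x
    unfolding d_def using that K by (intro partial_eq_0_outside[of K]) (auto simp: compact_imp_closed)
  obtain B where B: "\<bar>d x\<bar> \<le> B" for x
  proof -
    have "bounded (d ` K)"
      using K(1) smooth_continuous[OF d] compact_continuous_image compact_imp_bounded by blast
    then obtain B where "\<And>x. x \<in> K \<Longrightarrow> \<bar>d x\<bar> \<le> B" by (auto simp: bounded_iff)
    then have "\<bar>d x\<bar> \<le> max B 0" for x using d0[of x] by (cases "x \<in> K") (auto simp: le_max_iff_disj)
    then show ?thesis using that by blast
  qed
  obtain r where r: "\<And>x. x \<in> K \<Longrightarrow> norm x \<le> r" using compact_imp_bounded[OF K(1)] by (auto simp: bounded_iff)
  have meas: "f \<in> borel_measurable borel"
    using f by (simp add: borel_measurable_continuous_onI smooth_continuous)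
  have int_f: "integrable lborel f"
    using integrable_compact_support[OF smooth_continuous[OF f] K] by simp
  have int_ft: "integrable lborel (\<lambda>x. f (a + x))" for a
  proof (rule integrable_compact_support)
    show "continuous_on UNIV (\<lambda>x. f (a + x))"
      by (intro continuous_on_compose2[OF smooth_continuous[OF f, of UNIV]] continuous_intros) auto
    show "compact ((\<lambda>x. x - a) ` K)"
      using K(1) by (auto intro!: compact_continuous_image continuous_intros)
    show "f (a + x) = 0" if "x \<notin> (\<lambda>x. x - a) ` K" for x
    proof (rule K(2))
      show "a + x \<notin> K" using that by (metis add_diff_cancel_left' image_eqI)
    qed
  qed
  have "(LINT x|lborel. q n x) = 0" for n
    unfolding q_def using int_f int_ft lborel_integral_translate[OF meas]
    by (simp add: Bochner_Integration.integral_diff)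
  moreover have "(\<lambda>n. LINT x|lborel. q n x) \<longlonglongrightarrow> (LINT x|lborel. d x)"
  \<comment> \<open>The shifts have length at most 1 and \<open>K\<close> lies in the ball of radius
    \<open>r\<close>, so every quotient \<open>q n\<close> vanishes outside the ball of radius
    \<open>r + 1\<close>; inside, the mean value theorem bounds it by the supremum bound
    \<open>B\<close> of the derivative.\<close>
  proof (rule integral_dominated_convergence[where w = "\<lambda>x. B * indicator (cball 0 (r + 1)) x"])
    show "d \<in> borel_measurable lborel"
      using d by (simp add: borel_measurable_continuous_onI smooth_continuous)
    show "q n \<in> borel_measurable lborel" for n
      unfolding q_def using int_f int_ft by (intro borel_measurable_times borel_measurable_diff) auto
    show "integrable lborel (\<lambda>x. B * indicator (cball 0 (r + 1)) x)"
      by (auto intro!: integrable_mult_right integrable_real_indicator emeasure_lborel_cball_finite)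
    show "AE x in lborel. (\<lambda>n. q n x) \<longlonglongrightarrow> d x"
    proof (rule AE_I2)
      fix x
      have lim: "((\<lambda>t. (f (x + t *\<^sub>R e) - f x) / t) \<longlongrightarrow> d x) (at 0)"
        using deriv[of x 0] by (simp add: has_field_derivative_iff)
      have "filterlim (\<lambda>n. 1 / real (Suc n)) (at 0) sequentially"
        using LIMSEQ_inverse_real_of_nat by (simp add: filterlim_at inverse_eq_divide)
      from filterlim_compose[OF lim this] show "(\<lambda>n. q n x) \<longlonglongrightarrow> d x"
        by (simp add: q_def add.commute mult.commute)
    qed
    show "AE x in lborel. norm (q n x) \<le> B * indicator (cball 0 (r + 1)) x" for n
    proof (rule AE_I2)
      fix x :: "real ^ 'n"
      define s where "s = 1 / real (Suc n)"
      have s: "0 < s" "s \<le> 1" by (auto simp: s_def)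
      have q: "q n x = (f (x + s *\<^sub>R e) - f x) / s" by (simp add: q_def s_def add.commute mult.commute)
      show "norm (q n x) \<le> B * indicator (cball 0 (r + 1)) x"
      proof (cases "x \<in> cball 0 (r + 1)")
        case True
        obtain z where z: "f (x + s *\<^sub>R e) - f (x + 0 *\<^sub>R e) = (s - 0) * d (x + z *\<^sub>R e)"
          using MVT2[of 0 s "\<lambda>t. f (x + t *\<^sub>R e)" "\<lambda>t. d (x + t *\<^sub>R e)"] s deriv by blast
        then have "q n x = d (x + z *\<^sub>R e)" using s by (simp add: q)
        with True B show ?thesis by simp
      next
        case False
        have "norm (x + s *\<^sub>R e) \<ge> norm x - norm (s *\<^sub>R e)"
          by (rule norm_diff_ineq)
        moreover have "norm (s *\<^sub>R e) \<le> 1" using s by (simp add: e_def)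
        ultimately have "x + s *\<^sub>R e \<notin> K" "x \<notin> K" using r[of x] r[of "x + s *\<^sub>R e"] False by auto
        then show ?thesis using K(2) False by (simp add: q)
      qed
    qed
  qed
  ultimately show ?thesis by (simp add: LIMSEQ_const_iff d_def)
qed

text \<open>The product rule writes X f' as div(f X) - (div X) f. Compact support of
  \<open>f\<close> alone makes each \<open>X k y * f y\<close> compactly supported, so the
  divergence integrates to zero even for unbounded coefficients such as those of the soliton
  field.\<close>

lemma integral_by_parts:
  fixes f :: "real ^ 'n::finite \<Rightarrow> real"
  assumes X: "\<And>k. smooth (X k)" and f: "smooth f"
    and K: "compact K" "\<And>x. x \<notin> K \<Longrightarrow> f x = 0"
  shows "integrable lborel (\<lambda>x. \<Sum>k\<in>UNIV. X k x * partial k f x)"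
    and "(LINT x|lborel. (\<Sum>k\<in>UNIV. X k x * partial k f x))
      = - (LINT x|lborel. (\<Sum>k\<in>UNIV. partial k (X k) x) * f x)"
proof -
  have f0: "partial k f x = 0" if "x \<notin> K" for k x
    using partial_eq_0_outside[OF compact_imp_closed[OF K(1)], of f] K(2) that by simp
  have int_k: "integrable lborel (partial k (\<lambda>y. X k y * f y))" for k
    by (rule integrable_compact_support[OF smooth_continuous K(1)])
      (use X f K in \<open>auto intro: partial_eq_0_outside compact_imp_closed\<close>)
  have int_div: "integrable lborel (\<lambda>x. (\<Sum>k\<in>UNIV. partial k (X k) x) * f x)"
    by (rule integrable_compact_support[OF smooth_continuous K(1)])
      (use X f K in \<open>auto intro!: smooth_mult smooth_sum simp: smooth_partial\<close>)
  have eq: "(\<lambda>x. \<Sum>k\<in>UNIV. X k x * partial k f x)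
    = (\<lambda>x. (\<Sum>k\<in>UNIV. partial k (\<lambda>y. X k y * f y) x) - (\<Sum>k\<in>UNIV. partial k (X k) x) * f x)"
    by (simp add: partial_mult smooth_differentiable X f sum.distrib sum_distrib_right)
  show "integrable lborel (\<lambda>x. \<Sum>k\<in>UNIV. X k x * partial k f x)"
    unfolding eq using int_k int_div by auto
  have "(LINT x|lborel. partial k (\<lambda>y. X k y * f y) x) = 0" for k
    by (rule integral_partial_eq_0[OF smooth_mult[OF X f] K(1)]) (simp add: K(2))
  then show "(LINT x|lborel. (\<Sum>k\<in>UNIV. X k x * partial k f x))
      = - (LINT x|lborel. (\<Sum>k\<in>UNIV. partial k (X k) x) * f x)"
    unfolding eq using int_k int_div
    by (simp add: Bochner_Integration.integral_diff Bochner_Integration.integral_sum)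
qed

section \<open>Orthonormal frames with constant connection coefficients\<close>

text \<open>
  \<open>E x a\<close> is the frame vector \<open>e\<^sub>a\<close> at \<open>x\<close> and \<open>\<nabla>\<^bsub>e\<^sub>c\<^esub> e\<^sub>a = \<Sum>\<^sub>d \<omega> c a d e\<^sub>d\<close>. The last two assumptions say
  that the frame fields are divergence free, with respect to Lebesgue measure and to \<open>\<nabla>\<close>.
\<close>

locale orthonormal_frame =
  fixes g :: "'n::finite tensor2_field"
    and E :: "real ^ 'n \<Rightarrow> 'n \<Rightarrow> 'n \<Rightarrow> real"
    and \<omega> :: "'n \<Rightarrow> 'n \<Rightarrow> 'n \<Rightarrow> real"
  assumes E_smooth: "smooth (\<lambda>y. E y a i)"
    and christoffel_smooth: "smooth (\<lambda>y. christoffel g y k i j)"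
    and ginv_eq: "ginv g x i j = (\<Sum>a\<in>UNIV. E x a i * E x a j)"
    and connection: "(\<Sum>k\<in>UNIV. E x c k *
        (partial k (\<lambda>y. E y a i) x + (\<Sum>m\<in>UNIV. christoffel g x i k m * E x a m)))
      = (\<Sum>d\<in>UNIV. \<omega> c a d * E x d i)"
    and \<omega>_antisym: "\<omega> c a d = - \<omega> c d a"
    and E_div: "(\<Sum>k\<in>UNIV. partial k (\<lambda>y. E y c k) x) = 0"
    and \<omega>_trace: "(\<Sum>c\<in>UNIV. \<omega> c c d) = 0"
begin

text \<open>One slot is contracted with the frame vector e_a at a time. Frame components of higher
  rank are nested contractions, so a single differentiation rule for \<open>fr\<close> serves
  tensors of every rank.\<close>

definition fr :: "real ^ 'n \<Rightarrow> 'n \<Rightarrow> ('n \<Rightarrow> real) \<Rightarrow> real" where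
  "fr x a u = (\<Sum>i\<in>UNIV. E x a i * u i)"

definition fr2 :: "'n tensor2_field \<Rightarrow> real ^ 'n \<Rightarrow> 'n \<Rightarrow> 'n \<Rightarrow> real" where
  "fr2 h x a b = fr x a (\<lambda>i. fr x b (\<lambda>j. h x $ i $ j))"

definition fr3 :: "'n tensor3_field \<Rightarrow> real ^ 'n \<Rightarrow> 'n \<Rightarrow> 'n \<Rightarrow> 'n \<Rightarrow> real" where
  "fr3 T x c a b = fr x c (\<lambda>k. fr x a (\<lambda>i. fr x b (\<lambda>j. T x k i j)))"

definition fr4 :: "'n tensor4_field \<Rightarrow> real ^ 'n \<Rightarrow> 'n \<Rightarrow> 'n \<Rightarrow> 'n \<Rightarrow> 'n \<Rightarrow> real" where
  "fr4 R x a b c d = fr x a (\<lambda>i. fr x b (\<lambda>j. fr x c (\<lambda>k. fr x d (\<lambda>l. R x i j k l))))"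

definition dv :: "'n \<Rightarrow> (real ^ 'n \<Rightarrow> real) \<Rightarrow> real ^ 'n \<Rightarrow> real" where
  "dv c f x = (\<Sum>k\<in>UNIV. E x c k * partial k f x)"

text \<open>The matrix of the connection along e_c in coordinates: the \<open>m\<close>-th component
  of the covariant derivative of the coordinate field with index \<open>i\<close> in direction
  e_c.\<close>

definition con :: "real ^ 'n \<Rightarrow> 'n \<Rightarrow> 'n \<Rightarrow> 'n \<Rightarrow> real" where
  "con x c m i = (\<Sum>k\<in>UNIV. E x c k * christoffel g x m k i)"

section \<open>Contraction with the frame and metric traces\<close>

lemma fr_add: "fr x a (\<lambda>i. u i + v i) = fr x a u + fr x a v"
  by (simp add: fr_def distrib_left sum.distrib)

lemma fr_diff: "fr x a (\<lambda>i. u i - v i) = fr x a u - fr x a v"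
  by (simp add: fr_def right_diff_distrib sum_subtractf)

lemma fr_cmult: "fr x a (\<lambda>i. c * u i) = c * fr x a u"
  by (simp add: fr_def sum_distrib_left mult.left_commute)

lemma fr_multc: "fr x a (\<lambda>i. u i * c) = fr x a u * c"
  by (simp add: fr_def sum_distrib_right mult.assoc)

lemma fr_sum: "fr x a (\<lambda>i. \<Sum>s\<in>S. u i s) = (\<Sum>s\<in>S. fr x a (\<lambda>i. u i s))"
  unfolding fr_def by (subst sum.swap) (simp add: sum_distrib_left)

lemma fr_swap: "fr x a (\<lambda>i. fr x b (\<lambda>j. T i j)) = fr x b (\<lambda>j. fr x a (\<lambda>i. T i j))"
  unfolding fr_def sum_distrib_left by (subst sum.swap) (simp add: mult.left_commute)

lemma fr_0 [simp]: "fr x a (\<lambda>i. 0) = 0"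
  by (simp add: fr_def)

lemmas fr_linear = fr_add fr_diff fr_cmult fr_multc fr_sum

text \<open>By \<open>ginv_eq\<close> the inverse metric is the sum of the e_a tensor e_a, so a
  metric trace inserts the same frame vector into both slots.\<close>

lemma ginv_contract:
  "(\<Sum>i\<in>UNIV. \<Sum>j\<in>UNIV. ginv g x i j * T i j) = (\<Sum>a\<in>UNIV. fr x a (\<lambda>i. fr x a (\<lambda>j. T i j)))"
proof -
  have "(\<Sum>i\<in>UNIV. \<Sum>j\<in>UNIV. ginv g x i j * T i j)
    = (\<Sum>i\<in>UNIV. \<Sum>j\<in>UNIV. \<Sum>a\<in>UNIV. E x a i * (E x a j * T i j))"
    by (simp add: ginv_eq sum_distrib_right mult.assoc)
  also have "\<dots> = (\<Sum>i\<in>UNIV. \<Sum>a\<in>UNIV. \<Sum>j\<in>UNIV. E x a i * (E x a j * T i j))"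
    by (intro sum.cong refl sum.swap)
  also have "\<dots> = (\<Sum>a\<in>UNIV. \<Sum>i\<in>UNIV. \<Sum>j\<in>UNIV. E x a i * (E x a j * T i j))"
    by (rule sum.swap)
  finally show ?thesis by (simp add: fr_def sum_distrib_left)
qed

lemma inner2_eq: "inner2 g h h' x = (\<Sum>a\<in>UNIV. \<Sum>b\<in>UNIV. fr2 h x a b * fr2 h' x a b)"
proof -
  \<comment> \<open>Reordering the sums puts the two indices of each \<open>ginv\<close> next to
    each other, which is the shape \<open>ginv_contract\<close> needs.\<close>
  have "inner2 g h h' x = (\<Sum>i\<in>UNIV. \<Sum>k\<in>UNIV. \<Sum>j\<in>UNIV. \<Sum>l\<in>UNIV.
      ginv g x i k * (ginv g x j l * (h x $ i $ j * h' x $ k $ l)))"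
    unfolding inner2_def mult.assoc by (rule sum.cong[OF refl], rule sum.swap)
  also have "\<dots> = (\<Sum>i\<in>UNIV. \<Sum>k\<in>UNIV. ginv g x i k *
      (\<Sum>j\<in>UNIV. \<Sum>l\<in>UNIV. ginv g x j l * (h x $ i $ j * h' x $ k $ l)))"
    by (simp add: sum_distrib_left)
  also have "\<dots> = (\<Sum>a\<in>UNIV. \<Sum>b\<in>UNIV. fr2 h x a b * fr2 h' x a b)"
    by (simp add: ginv_contract fr2_def fr_linear)
  finally show ?thesis .
qed

lemma inner3_eq:
  "inner3 g T T' x = (\<Sum>c\<in>UNIV. \<Sum>a\<in>UNIV. \<Sum>b\<in>UNIV. fr3 T x c a b * fr3 T' x c a b)"
proof -
  have "inner3 g T T' x = (\<Sum>i\<in>UNIV. \<Sum>j\<in>UNIV. \<Sum>a\<in>UNIV. \<Sum>k\<in>UNIV. \<Sum>b\<in>UNIV. \<Sum>c\<in>UNIV.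
      ginv g x i a * (ginv g x j b * (ginv g x k c * (T x i j k * T' x a b c))))"
    unfolding inner3_def mult.assoc by (rule sum.cong[OF refl], rule sum.cong[OF refl], rule sum.swap)
  also have "\<dots> = (\<Sum>i\<in>UNIV. \<Sum>a\<in>UNIV. \<Sum>j\<in>UNIV. \<Sum>k\<in>UNIV. \<Sum>b\<in>UNIV. \<Sum>c\<in>UNIV.
      ginv g x i a * (ginv g x j b * (ginv g x k c * (T x i j k * T' x a b c))))"
    by (rule sum.cong[OF refl], rule sum.swap)
  also have "\<dots> = (\<Sum>i\<in>UNIV. \<Sum>a\<in>UNIV. \<Sum>j\<in>UNIV. \<Sum>b\<in>UNIV. \<Sum>k\<in>UNIV. \<Sum>c\<in>UNIV.
      ginv g x i a * (ginv g x j b * (ginv g x k c * (T x i j k * T' x a b c))))"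
    by (rule sum.cong[OF refl], rule sum.cong[OF refl], rule sum.cong[OF refl], rule sum.swap)
  also have "\<dots> = (\<Sum>i\<in>UNIV. \<Sum>a\<in>UNIV. ginv g x i a * (\<Sum>j\<in>UNIV. \<Sum>b\<in>UNIV. ginv g x j b *
      (\<Sum>k\<in>UNIV. \<Sum>c\<in>UNIV. ginv g x k c * (T x i j k * T' x a b c))))"
    by (simp add: sum_distrib_left)
  also have "\<dots> = (\<Sum>c\<in>UNIV. \<Sum>a\<in>UNIV. \<Sum>b\<in>UNIV. fr3 T x c a b * fr3 T' x c a b)"
    by (simp add: ginv_contract fr3_def fr_linear)
  finally show ?thesis .
qed

section \<open>Differentiation along the frame and covariant derivatives\<close>

lemma smooth_fr [intro]: "(\<And>i. smooth (u i)) \<Longrightarrow> smooth (\<lambda>y. fr y a (\<lambda>i. u i y))"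
  unfolding fr_def by (intro smooth_sum smooth_mult E_smooth)

lemma smooth_fr2: "smooth_tensor2 h \<Longrightarrow> smooth (\<lambda>y. fr2 h y a b)"
  unfolding fr2_def smooth_tensor2_def by (intro smooth_fr) auto

lemma smooth_dv: "smooth f \<Longrightarrow> smooth (dv c f)"
  unfolding dv_def[abs_def] by (intro smooth_sum smooth_mult E_smooth smooth_partial)

lemma smooth_cov_deriv2: "smooth_tensor2 h \<Longrightarrow> smooth (\<lambda>y. cov_deriv2 g h y k i j)"
  unfolding cov_deriv2_def smooth_tensor2_def
  by (intro smooth_diff smooth_sum smooth_mult christoffel_smooth smooth_partial) auto

lemma dv_mult:
  "f differentiable (at x) \<Longrightarrow> f' differentiable (at x) \<Longrightarrow>
    dv c (\<lambda>y. f y * f' y) x = dv c f x * f' x + f x * dv c f' x"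
  by (simp add: dv_def partial_mult algebra_simps sum.distrib sum_distrib_left sum_distrib_right)

lemma dv_sum:
  "(\<And>s. s \<in> S \<Longrightarrow> f s differentiable (at x)) \<Longrightarrow>
    dv c (\<lambda>y. \<Sum>s\<in>S. f s y) x = (\<Sum>s\<in>S. dv c (f s) x)"
  unfolding dv_def by (subst sum.swap) (simp add: partial_sum sum_distrib_left)

text \<open>The assumption \<open>connection\<close> is the coordinate form of the covariant
  derivative of e_a along e_c; here it is solved for the plain derivative of the components of
  e_a.\<close>

lemma dv_frame:
  "dv c (\<lambda>y. E y a i) x = (\<Sum>d\<in>UNIV. \<omega> c a d * E x d i) - (\<Sum>m\<in>UNIV. con x c i m * E x a m)"
proof -
  have "(\<Sum>m\<in>UNIV. con x c i m * E x a m)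
      = (\<Sum>k\<in>UNIV. E x c k * (\<Sum>m\<in>UNIV. christoffel g x i k m * E x a m))"
    unfolding con_def sum_distrib_left sum_distrib_right
    by (subst sum.swap) (simp add: mult.assoc)
  then show ?thesis
    by (simp add: dv_def connection[symmetric] distrib_left sum.distrib)
qed

text \<open>Applied to one slot at a time, this computes covariant derivatives of tensors in the frame.\<close>

lemma dv_fr:
  assumes u: "\<And>i. smooth (u i)"
  shows "dv c (\<lambda>y. fr y a (\<lambda>i. u i y)) x =
    fr x a (\<lambda>i. dv c (u i) x - (\<Sum>m\<in>UNIV. con x c m i * u m x))
    + (\<Sum>d\<in>UNIV. \<omega> c a d * fr x d (\<lambda>i. u i x))"
proof -
  have "dv c (\<lambda>y. fr y a (\<lambda>i. u i y)) x
      = (\<Sum>i\<in>UNIV. dv c (\<lambda>y. E y a i) x * u i x) + fr x a (\<lambda>i. dv c (u i) x)"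
    unfolding fr_def using u E_smooth
    by (simp add: dv_sum dv_mult smooth_differentiable smooth_mult sum.distrib)
  moreover have "(\<Sum>i\<in>UNIV. \<Sum>d\<in>UNIV. \<omega> c a d * E x d i * u i x)
      = (\<Sum>d\<in>UNIV. \<omega> c a d * fr x d (\<lambda>i. u i x))"
    unfolding fr_def sum_distrib_left by (subst sum.swap) (simp add: mult.assoc)
  \<comment> \<open>Exchanging the two summation indices moves the Christoffel term from the frame
    vector onto the slot of the tensor, where it becomes the correction in the covariant
    derivative.\<close>
  moreover have "(\<Sum>i\<in>UNIV. \<Sum>m\<in>UNIV. con x c i m * E x a m * u i x)
      = fr x a (\<lambda>i. \<Sum>m\<in>UNIV. con x c m i * u m x)"
    unfolding fr_def sum_distrib_left by (subst sum.swap) (simp add: mult_ac)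
  ultimately show ?thesis
    by (simp add: dv_frame left_diff_distrib sum_distrib_right sum_subtractf fr_diff)
qed

lemma fr_partial: "fr x c (\<lambda>k. partial k f x) = dv c f x"
  by (simp add: fr_def dv_def)

lemma fr_christoffel: "fr x c (\<lambda>k. christoffel g x m k i) = con x c m i"
  by (simp add: fr_def con_def)

text \<open>Applying \<open>dv_fr\<close> once for each slot of \<open>h\<close> absorbs all
  Christoffel symbols and leaves only the constant coefficients \<omega>.\<close>

lemma fr_cov_deriv2:
  assumes "smooth_tensor2 h"
  shows "fr3 (cov_deriv2 g h) x c a b = dv c (\<lambda>y. fr2 h y a b) x
    - (\<Sum>d\<in>UNIV. \<omega> c a d * fr2 h x d b) - (\<Sum>d\<in>UNIV. \<omega> c b d * fr2 h x a d)"
proof -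
  have h: "smooth (\<lambda>y. h y $ i $ j)" for i j using assms by (simp add: smooth_tensor2_def)
  \<comment> \<open>With the differentiation slot innermost, \<open>fr_partial\<close> and
    \<open>fr_christoffel\<close> turn the coordinate formula into \<open>dv\<close> and
    \<open>con\<close>.\<close>
  have "fr3 (cov_deriv2 g h) x c a b
      = fr x a (\<lambda>i. fr x b (\<lambda>j. fr x c (\<lambda>k. cov_deriv2 g h x k i j)))"
    unfolding fr3_def fr_swap[of x c a] by (subst fr_swap[of x c b]) (rule refl)
  then show ?thesis
    by (simp add: cov_deriv2_def fr2_def dv_fr smooth_fr h fr_linear fr_partial fr_christoffel)
qed

lemma fr_cov_deriv3:
  assumes T: "\<And>k i j. smooth (\<lambda>y. T y k i j)"
  shows "fr4 (cov_deriv3 g T) x p c a b = dv p (\<lambda>y. fr3 T y c a b) x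
    - (\<Sum>d\<in>UNIV. \<omega> p c d * fr3 T x d a b) - (\<Sum>d\<in>UNIV. \<omega> p a d * fr3 T x c d b)
    - (\<Sum>d\<in>UNIV. \<omega> p b d * fr3 T x c a d)"
proof -
  have "fr4 (cov_deriv3 g T) x p c a b
      = fr x c (\<lambda>k. fr x a (\<lambda>i. fr x b (\<lambda>j. fr x p (\<lambda>l. cov_deriv3 g T x l k i j))))"
    unfolding fr4_def fr_swap[of x p c]
    by (subst fr_swap[of x p a], subst fr_swap[of x p b]) (rule refl)
  then show ?thesis
    by (simp add: cov_deriv3_def fr3_def dv_fr smooth_fr T fr_linear fr_partial fr_christoffel)
qed


section \<open>The rough Laplacian and its energy identity\<close>

lemma fr2_rough_laplacian:
  assumes h: "smooth_tensor2 h"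
  shows "fr2 (rough_laplacian g h) x a b = (\<Sum>c\<in>UNIV. dv c (\<lambda>y. fr3 (cov_deriv2 g h) y c a b) x
    - (\<Sum>d\<in>UNIV. \<omega> c a d * fr3 (cov_deriv2 g h) x c d b)
    - (\<Sum>d\<in>UNIV. \<omega> c b d * fr3 (cov_deriv2 g h) x c a d))"
proof -
  \<comment> \<open>Tracing the second covariant derivative creates one connection term in the
    differentiation slot; it carries the trace of \<omega> and therefore vanishes.\<close>
  have "(\<Sum>c\<in>UNIV. \<Sum>d\<in>UNIV. \<omega> c c d * fr3 (cov_deriv2 g h) x d a b)
      = (\<Sum>d\<in>UNIV. (\<Sum>c\<in>UNIV. \<omega> c c d) * fr3 (cov_deriv2 g h) x d a b)"
    by (subst sum.swap) (simp add: sum_distrib_right)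
  then have trace: "(\<Sum>c\<in>UNIV. \<Sum>d\<in>UNIV. \<omega> c c d * fr3 (cov_deriv2 g h) x d a b) = 0"
    by (simp add: \<omega>_trace)
  have "fr2 (rough_laplacian g h) x a b
      = (\<Sum>c\<in>UNIV. fr x a (\<lambda>i. fr x b (\<lambda>j. fr x c (\<lambda>l. fr x c (\<lambda>k.
          cov_deriv3 g (cov_deriv2 g h) x l k i j)))))"
    by (simp add: fr2_def rough_laplacian_def ginv_contract fr_sum)
  also have "\<dots> = (\<Sum>c\<in>UNIV. fr4 (cov_deriv3 g (cov_deriv2 g h)) x c c a b)"
  proof (rule sum.cong[OF refl])
    fix c
    show "fr x a (\<lambda>i. fr x b (\<lambda>j. fr x c (\<lambda>l. fr x c (\<lambda>k. cov_deriv3 g (cov_deriv2 g h) x l k i j))))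
      = fr4 (cov_deriv3 g (cov_deriv2 g h)) x c c a b"
      unfolding fr4_def fr_swap[of x b c] fr_swap[of x a c] by (rule refl)
  qed
  finally show ?thesis
    using trace by (simp add: fr_cov_deriv3 smooth_cov_deriv2[OF h] sum_subtractf)
qed

text \<open>Metric compatibility makes the matrix \<open>\<omega> c\<close> skew-adjoint. This
  shifts connection terms from \<open>h\<close> to its covariant derivative.\<close>

lemma \<omega>_skew:
  "(\<Sum>a\<in>UNIV. u a * (\<Sum>d\<in>UNIV. \<omega> c a d * v d)) = - (\<Sum>a\<in>UNIV. (\<Sum>d\<in>UNIV. \<omega> c a d * u d) * v a)"
proof -
  have "(\<Sum>a\<in>UNIV. u a * (\<Sum>d\<in>UNIV. \<omega> c a d * v d)) = (\<Sum>d\<in>UNIV. \<Sum>a\<in>UNIV. \<omega> c a d * u a * v d)"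
    unfolding sum_distrib_left by (subst sum.swap) (simp add: mult_ac)
  also have "\<dots> = (\<Sum>d\<in>UNIV. \<Sum>a\<in>UNIV. - (\<omega> c d a * u a * v d))"
    by (subst \<omega>_antisym) simp
  finally show ?thesis by (simp add: sum_negf sum_distrib_right)
qed

text \<open>Leibniz rule for the vector field V with frame components V_c, the pairing of the
  covariant derivative of \<open>h\<close> along e_c with \<open>h\<close>. Its divergence is the
  Laplacian term plus the squared norm of the derivative; the connection terms match up by skewness
  of \<omega>.\<close>

lemma inner2_rough_laplacian:
  assumes h: "smooth_tensor2 h"
  shows "inner2 g (rough_laplacian g h) h x =
    (\<Sum>c\<in>UNIV. dv c (\<lambda>y. \<Sum>a\<in>UNIV. \<Sum>b\<in>UNIV. fr3 (cov_deriv2 g h) y c a b * fr2 h y a b) x)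
    - inner3 g (cov_deriv2 g h) (cov_deriv2 g h) x"
proof -
  define H where "H = fr2 h"
  define T where "T = fr3 (cov_deriv2 g h)"
  have smooth_H: "smooth (\<lambda>y. H y a b)" for a b
    unfolding H_def by (rule smooth_fr2[OF h])
  have smooth_T: "smooth (\<lambda>y. T y c a b)" for c a b
    unfolding T_def fr3_def by (intro smooth_fr smooth_cov_deriv2 h)
  have dv_H: "dv c (\<lambda>y. H y a b) x = T x c a b
      + (\<Sum>d\<in>UNIV. \<omega> c a d * H x d b) + (\<Sum>d\<in>UNIV. \<omega> c b d * H x a d)" for c a b
    unfolding H_def T_def fr_cov_deriv2[OF h] by simp
  have skew1: "(\<Sum>a\<in>UNIV. \<Sum>b\<in>UNIV. T x c a b * (\<Sum>d\<in>UNIV. \<omega> c a d * H x d b))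
      = - (\<Sum>a\<in>UNIV. \<Sum>b\<in>UNIV. (\<Sum>d\<in>UNIV. \<omega> c a d * T x c d b) * H x a b)" for c
  proof -
    \<comment> \<open>Here \<omega> acts on the first slot, so the sum over \<open>b\<close> must be
      outermost before \<open>\<omega>_skew\<close> applies.\<close>
    have "(\<Sum>a\<in>UNIV. \<Sum>b\<in>UNIV. T x c a b * (\<Sum>d\<in>UNIV. \<omega> c a d * H x d b))
        = (\<Sum>b\<in>UNIV. \<Sum>a\<in>UNIV. T x c a b * (\<Sum>d\<in>UNIV. \<omega> c a d * H x d b))"
      by (rule sum.swap)
    also have "\<dots> = - (\<Sum>b\<in>UNIV. \<Sum>a\<in>UNIV. (\<Sum>d\<in>UNIV. \<omega> c a d * T x c d b) * H x a b)"
      unfolding \<omega>_skew[of "\<lambda>a. T x c a b" c "\<lambda>d. H x d b" for b] by (simp add: sum_negf)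
    also have "(\<Sum>b\<in>UNIV. \<Sum>a\<in>UNIV. (\<Sum>d\<in>UNIV. \<omega> c a d * T x c d b) * H x a b)
        = (\<Sum>a\<in>UNIV. \<Sum>b\<in>UNIV. (\<Sum>d\<in>UNIV. \<omega> c a d * T x c d b) * H x a b)"
      by (rule sum.swap)
    finally show ?thesis .
  qed
  have skew2: "(\<Sum>a\<in>UNIV. \<Sum>b\<in>UNIV. T x c a b * (\<Sum>d\<in>UNIV. \<omega> c b d * H x a d))
      = - (\<Sum>a\<in>UNIV. \<Sum>b\<in>UNIV. (\<Sum>d\<in>UNIV. \<omega> c b d * T x c a d) * H x a b)" for c
    unfolding \<omega>_skew[of "T x c a" c "H x a" for a] by (simp add: sum_negf)
  \<comment> \<open>\<open>S c a b\<close> is the contribution of direction e_c to the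
    \<open>(a, b)\<close> frame component of the rough Laplacian.\<close>
  define S where "S c a b = dv c (\<lambda>y. T y c a b) x
    - (\<Sum>d\<in>UNIV. \<omega> c a d * T x c d b) - (\<Sum>d\<in>UNIV. \<omega> c b d * T x c a d)" for c a b
  have dv_V: "dv c (\<lambda>y. \<Sum>a\<in>UNIV. \<Sum>b\<in>UNIV. T y c a b * H y a b) x
      = (\<Sum>a\<in>UNIV. \<Sum>b\<in>UNIV. S c a b * H x a b) + (\<Sum>a\<in>UNIV. \<Sum>b\<in>UNIV. T x c a b * T x c a b)" for c
  proof -
    have "dv c (\<lambda>y. \<Sum>a\<in>UNIV. \<Sum>b\<in>UNIV. T y c a b * H y a b) x
        = (\<Sum>a\<in>UNIV. \<Sum>b\<in>UNIV. dv c (\<lambda>y. T y c a b) x * H x a b)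
        + (\<Sum>a\<in>UNIV. \<Sum>b\<in>UNIV. T x c a b * dv c (\<lambda>y. H y a b) x)"
      by (simp add: dv_sum dv_mult smooth_differentiable smooth_sum smooth_mult smooth_H smooth_T
          sum.distrib)
    then show ?thesis
      unfolding dv_H S_def distrib_left left_diff_distrib sum.distrib sum_subtractf skew1 skew2
      by linarith
  qed
  have "inner2 g (rough_laplacian g h) h x = (\<Sum>a\<in>UNIV. \<Sum>b\<in>UNIV. \<Sum>c\<in>UNIV. S c a b * H x a b)"
    unfolding inner2_eq fr2_rough_laplacian[OF h] T_def H_def S_def sum_distrib_right by (rule refl)
  also have "\<dots> = (\<Sum>a\<in>UNIV. \<Sum>c\<in>UNIV. \<Sum>b\<in>UNIV. S c a b * H x a b)"
    by (rule sum.cong[OF refl], rule sum.swap)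
  also have "\<dots> = (\<Sum>c\<in>UNIV. \<Sum>a\<in>UNIV. \<Sum>b\<in>UNIV. S c a b * H x a b)"
    by (rule sum.swap)
  finally show ?thesis
    unfolding T_def[symmetric] H_def[symmetric] dv_V inner3_eq by (simp add: sum.distrib)
qed

lemma integral_dv_eq_0:
  assumes f: "smooth f" and K: "compact K" "\<And>x. x \<notin> K \<Longrightarrow> f x = 0"
  shows "(LINT x|lborel. dv c f x) = 0"
  using integral_by_parts(2)[OF E_smooth f K] by (simp add: dv_def E_div)

text \<open>The components of V inherit smoothness and compact support from \<open>h\<close>, and
  the frame fields preserve Lebesgue measure by \<open>E_div\<close>, so the divergence term
  integrates to zero.\<close>

lemma integral_inner2_rough_laplacian:
  assumes h: "smooth_tensor2 h" and K: "compact K" "\<And>x. x \<notin> K \<Longrightarrow> h x = 0"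
  shows "integrable lborel (inner2 g (rough_laplacian g h) h)"
    and "(LINT x|lborel. inner2 g (rough_laplacian g h) h x)
      = - (LINT x|lborel. inner3 g (cov_deriv2 g h) (cov_deriv2 g h) x)"
proof -
  define V where "V c y = (\<Sum>a\<in>UNIV. \<Sum>b\<in>UNIV. fr3 (cov_deriv2 g h) y c a b * fr2 h y a b)" for c y
  have smooth_T: "smooth (\<lambda>y. fr3 (cov_deriv2 g h) y c a b)" for c a b
    unfolding fr3_def by (intro smooth_fr smooth_cov_deriv2 h)
  have V: "smooth (V c)" for c
    unfolding V_def[abs_def] by (intro smooth_sum smooth_mult smooth_fr2 h smooth_T)
  have V0: "V c x = 0" if "x \<notin> K" for c x
    using K(2)[OF that] by (simp add: V_def fr2_def)
  have dV0: "dv c (V c) x = 0" if "x \<notin> K" for c x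
    using partial_eq_0_outside[OF compact_imp_closed[OF K(1)], of "V c"] V0 that by (simp add: dv_def)
  have N: "smooth (inner3 g (cov_deriv2 g h) (cov_deriv2 g h))"
    unfolding inner3_eq[abs_def] by (intro smooth_sum smooth_mult smooth_T)
  have cov0: "cov_deriv2 g h x k i j = 0" if "x \<notin> K" for x k i j
    using partial_eq_0_outside[OF compact_imp_closed[OF K(1)], of "\<lambda>y. h y $ i $ j"] K(2) that
    by (simp add: cov_deriv2_def)
  have int_dV: "integrable lborel (dv c (V c))" for c
    by (rule integrable_compact_support[OF smooth_continuous K(1)]) (use V dV0 smooth_dv in auto)
  have int_N: "integrable lborel (inner3 g (cov_deriv2 g h) (cov_deriv2 g h))"
    by (rule integrable_compact_support[OF smooth_continuous[OF N] K(1)])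
      (simp add: inner3_eq fr3_def cov0)
  have eq: "inner2 g (rough_laplacian g h) h
      = (\<lambda>x. (\<Sum>c\<in>UNIV. dv c (V c) x) - inner3 g (cov_deriv2 g h) (cov_deriv2 g h) x)"
    by (rule ext) (simp add: inner2_rough_laplacian[OF h] V_def[abs_def])
  show "integrable lborel (inner2 g (rough_laplacian g h) h)"
    unfolding eq using int_dV int_N by auto
  have "(LINT x|lborel. dv c (V c) x) = 0" for c
    by (rule integral_dv_eq_0[OF V K(1) V0])
  then show "(LINT x|lborel. inner2 g (rough_laplacian g h) h x)
      = - (LINT x|lborel. inner3 g (cov_deriv2 g h) (cov_deriv2 g h) x)"
    unfolding eq using int_dV int_N by (simp add: Bochner_Integration.integral_diff Bochner_Integration.integral_sum)
qed

section \<open>Curvature terms in the frame\<close>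

lemma contract_raise_both:
  "(\<Sum>p\<in>UNIV. \<Sum>q\<in>UNIV. R p q * raise_both g h x p q)
    = (\<Sum>c\<in>UNIV. \<Sum>d\<in>UNIV. fr x c (\<lambda>p. fr x d (\<lambda>q. R p q)) * fr2 h x c d)"
proof -
  have "(\<Sum>p\<in>UNIV. \<Sum>q\<in>UNIV. R p q * raise_both g h x p q)
      = (\<Sum>p\<in>UNIV. \<Sum>q\<in>UNIV. \<Sum>a\<in>UNIV. \<Sum>b\<in>UNIV.
          ginv g x p a * (ginv g x q b * (R p q * h x $ a $ b)))"
    by (simp add: raise_both_def sum_distrib_left mult_ac)
  also have "\<dots> = (\<Sum>p\<in>UNIV. \<Sum>a\<in>UNIV. \<Sum>q\<in>UNIV. \<Sum>b\<in>UNIV.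
          ginv g x p a * (ginv g x q b * (R p q * h x $ a $ b)))"
    by (rule sum.cong[OF refl], rule sum.swap)
  also have "\<dots> = (\<Sum>p\<in>UNIV. \<Sum>a\<in>UNIV. ginv g x p a *
      (\<Sum>q\<in>UNIV. \<Sum>b\<in>UNIV. ginv g x q b * (R p q * h x $ a $ b)))"
    by (simp add: sum_distrib_left)
  also have "\<dots> = (\<Sum>c\<in>UNIV. \<Sum>d\<in>UNIV. fr x c (\<lambda>p. fr x d (\<lambda>q. R p q)) * fr2 h x c d)"
    by (simp add: ginv_contract fr2_def fr_linear)
  finally show ?thesis .
qed

text \<open>In an orthonormal frame raising an index does not change components, so the mixed
  contraction is a plain sum over frame indices.\<close>

lemma contract_raise_second:
  "(\<Sum>k\<in>UNIV. raise_second g S x i k * u k) = (\<Sum>c\<in>UNIV. fr x c (\<lambda>a. S x $ i $ a) * fr x c u)"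
proof -
  have "(\<Sum>k\<in>UNIV. raise_second g S x i k * u k)
      = (\<Sum>k\<in>UNIV. \<Sum>a\<in>UNIV. ginv g x k a * (S x $ i $ a * u k))"
    by (simp add: raise_second_def sum_distrib_right mult.assoc)
  then show ?thesis by (simp add: ginv_contract fr_linear)
qed

lemma fr2_ricci: "fr2 (ricci g) x a b = (\<Sum>c\<in>UNIV. fr4 (riemann g) x c a b c)"
proof -
  have "fr2 (ricci g) x a b = (\<Sum>c\<in>UNIV. fr x a (\<lambda>i. fr x b (\<lambda>j. fr x c (\<lambda>p. fr x c (\<lambda>q. riemann g x p i j q)))))"
    by (simp add: fr2_def ricci_def ginv_contract fr_sum)
  also have "\<dots> = (\<Sum>c\<in>UNIV. fr4 (riemann g) x c a b c)"
  proof (rule sum.cong[OF refl])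
    fix c
    show "fr x a (\<lambda>i. fr x b (\<lambda>j. fr x c (\<lambda>p. fr x c (\<lambda>q. riemann g x p i j q)))) = fr4 (riemann g) x c a b c"
      unfolding fr4_def fr_swap[of x b c] by (subst fr_swap[of x a c]) (rule refl)
  qed
  finally show ?thesis .
qed

lemma fr2_lichnerowicz:
  "fr2 (lichnerowicz g h) x a b = fr2 (rough_laplacian g h) x a b
    + 2 * (\<Sum>c\<in>UNIV. \<Sum>d\<in>UNIV. fr4 (riemann g) x a c d b * fr2 h x c d)
    - (\<Sum>c\<in>UNIV. fr2 (ricci g) x a c * fr2 h x c b)
    - (\<Sum>c\<in>UNIV. fr2 (ricci g) x b c * fr2 h x a c)"
proof -
  \<comment> \<open>In \<open>fr2\<close> the free slots \<open>i\<close> and \<open>j\<close> are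
    outermost, whereas \<open>fr4\<close> follows the order of the curvature indices.\<close>
  have curv: "fr4 (riemann g) x a c d b
      = fr x a (\<lambda>i. fr x b (\<lambda>j. fr x c (\<lambda>p. fr x d (\<lambda>q. riemann g x i p q j))))" for c d
    unfolding fr4_def fr_swap[of x b c] by (subst fr_swap[of x b d]) (rule refl)
  have ric1: "fr x a (\<lambda>i. fr x b (\<lambda>j. \<Sum>k\<in>UNIV. raise_second g (ricci g) x i k * h x $ k $ j))
      = (\<Sum>c\<in>UNIV. fr2 (ricci g) x a c * fr2 h x c b)"
    unfolding contract_raise_second fr_sum fr2_def fr_swap[of x _ b] by (simp only: fr_cmult fr_multc)
  have ric2: "fr x a (\<lambda>i. fr x b (\<lambda>j. \<Sum>k\<in>UNIV. raise_second g (ricci g) x j k * h x $ i $ k))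
      = (\<Sum>c\<in>UNIV. fr2 (ricci g) x b c * fr2 h x a c)"
    unfolding contract_raise_second fr_sum fr2_def by (simp only: fr_cmult fr_multc mult.commute)
  show ?thesis
    using ric1 ric2
    by (simp add: fr2_def[of "lichnerowicz g h"] fr2_def[of "rough_laplacian g h"] lichnerowicz_def
        fr_add fr_diff contract_raise_both curv fr_linear)
qed

section \<open>The Lie derivative in the frame\<close>

text \<open>The assumption on \<open>X\<close> says \<open>\<L>\<^sub>X e\<^sub>a = \<lambda>\<^sub>a e\<^sub>a\<close>.\<close>

lemma fr2_lie_deriv2:
  assumes h: "smooth_tensor2 h"
    and X: "\<And>a i. (\<Sum>k\<in>UNIV. X x $ k * partial k (\<lambda>y. E y a i) x)
      - (\<Sum>k\<in>UNIV. E x a k * partial k (\<lambda>y. X y $ i) x) = lam a * E x a i"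
  shows "fr2 (lie_deriv2 X h) x a b
    = (\<Sum>k\<in>UNIV. X x $ k * partial k (\<lambda>y. fr2 h y a b) x) - (lam a + lam b) * fr2 h x a b"
proof -
  define vd where "vd f = (\<Sum>k\<in>UNIV. X x $ k * partial k f x)" for f
  define D where "D k i = partial k (\<lambda>y. X y $ i) x" for k i
  have vd_E: "vd (\<lambda>y. E y a i) = (\<Sum>k\<in>UNIV. E x a k * D k i) + lam a * E x a i" for a i
    using X[of a i] by (simp add: vd_def D_def)
  \<comment> \<open>Differentiating a frame vector along \<open>X\<close> yields two pieces: the
    derivative of \<open>X\<close>, which after an index exchange is the term of
    \<open>lie_deriv2\<close> for this slot, and the multiple \<open>lam a\<close> of the frame
    vector.\<close>
  have slot: "vd (\<lambda>y. fr y a (\<lambda>i. u i y))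
      = fr x a (\<lambda>i. vd (u i) + (\<Sum>k\<in>UNIV. u k x * D i k)) + lam a * fr x a (\<lambda>i. u i x)"
    if u: "\<And>i. smooth (u i)" for a u
  proof -
    have "vd (\<lambda>y. fr y a (\<lambda>i. u i y))
        = (\<Sum>k\<in>UNIV. \<Sum>i\<in>UNIV. X x $ k * partial k (\<lambda>y. E y a i) x * u i x
            + E x a i * (X x $ k * partial k (u i) x))"
      unfolding vd_def fr_def using u E_smooth
      by (simp add: partial_sum partial_mult smooth_differentiable smooth_mult sum_distrib_left algebra_simps)
    also have "\<dots> = (\<Sum>i\<in>UNIV. vd (\<lambda>y. E y a i) * u i x) + fr x a (\<lambda>i. vd (u i))"
      unfolding vd_def fr_def by (subst sum.swap) (simp add: sum.distrib sum_distrib_left sum_distrib_right)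
    also have "(\<Sum>i\<in>UNIV. vd (\<lambda>y. E y a i) * u i x)
        = (\<Sum>i\<in>UNIV. \<Sum>k\<in>UNIV. E x a k * (u i x * D k i)) + lam a * fr x a (\<lambda>i. u i x)"
      by (simp add: vd_E fr_def distrib_right sum.distrib sum_distrib_left sum_distrib_right mult.assoc
          mult.commute[of "D _ _"])
    also have "(\<Sum>i\<in>UNIV. \<Sum>k\<in>UNIV. E x a k * (u i x * D k i))
        = fr x a (\<lambda>k. \<Sum>i\<in>UNIV. u i x * D k i)"
      unfolding fr_def by (subst sum.swap) (simp add: sum_distrib_left)
    finally show ?thesis by (simp add: fr_add)
  qed
  have smooth_h: "smooth (\<lambda>y. h y $ i $ j)" for i j using h by (simp add: smooth_tensor2_def)
  have lie: "lie_deriv2 X h x $ i $ j = vd (\<lambda>y. h y $ i $ j)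
      + (\<Sum>k\<in>UNIV. h x $ k $ j * D i k) + (\<Sum>k\<in>UNIV. h x $ i $ k * D j k)" for i j
    by (simp add: lie_deriv2_def vd_def D_def sum.distrib)
  have "vd (\<lambda>y. fr2 h y a b) = fr2 (lie_deriv2 X h) x a b + (lam a + lam b) * fr2 h x a b"
    by (simp add: fr2_def lie slot smooth_fr smooth_h fr_linear algebra_simps)
  then show ?thesis by (simp add: vd_def)
qed

lemma fr2_symmetric: "symmetric_tensor2 h \<Longrightarrow> fr2 h x a b = fr2 h x b a"
proof -
  assume "symmetric_tensor2 h"
  then have "h x $ i $ j = h x $ j $ i" for i j
    unfolding symmetric_tensor2_def transpose_def by (metis vec_lambda_beta)
  then show ?thesis unfolding fr2_def by (subst fr_swap) simp
qed

section \<open>From the pointwise quadratic form to the integral inequality\<close>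

lemma fr2_flow_linearization:
  "fr2 (flow_linearization g X \<alpha> h) x a b
    = fr2 (lichnerowicz g h) x a b - fr2 (lie_deriv2 X h) x a b - \<alpha> * fr2 h x a b"
  by (simp add: fr2_def flow_linearization_def fr_diff fr_cmult)

text \<open>
  The zeroth order part of \<open>\<langle>Lh, h\<rangle>\<close> at \<open>H = h\<close>, in the frame, for a curvature tensor \<open>Rm\<close> and a field
  \<open>X\<close> with \<open>\<L>\<^sub>X e\<^sub>a = \<lambda>\<^sub>a e\<^sub>a\<close>.
\<close>

definition potential ::
  "('n \<Rightarrow> 'n \<Rightarrow> 'n \<Rightarrow> 'n \<Rightarrow> real) \<Rightarrow> ('n \<Rightarrow> real) \<Rightarrow> real \<Rightarrow> ('n \<Rightarrow> 'n \<Rightarrow> real) \<Rightarrow> real" where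
  "potential Rm lam \<alpha> H = (\<Sum>a\<in>UNIV. \<Sum>b\<in>UNIV.
    (2 * (\<Sum>c\<in>UNIV. \<Sum>d\<in>UNIV. Rm a c d b * H c d)
     - (\<Sum>c\<in>UNIV. (\<Sum>p\<in>UNIV. Rm p a c p) * H c b) - (\<Sum>c\<in>UNIV. (\<Sum>p\<in>UNIV. Rm p b c p) * H a c)
     + (lam a + lam b - \<alpha>) * H a b) * H a b)"

text \<open>Besides the rough Laplacian only the transport part of the Lie derivative differentiates
  \<open>h\<close>; paired with \<open>h\<close> it is half the derivative of the squared norm along
  \<open>X\<close>. Everything else is algebraic in \<open>h\<close> and is collected in
  \<open>potential\<close>.\<close>

lemma inner2_flow_linearization:
  assumes h: "smooth_tensor2 h"
    and X: "\<And>a i. (\<Sum>k\<in>UNIV. X x $ k * partial k (\<lambda>y. E y a i) x)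
      - (\<Sum>k\<in>UNIV. E x a k * partial k (\<lambda>y. X y $ i) x) = lam a * E x a i"
  shows "inner2 g (flow_linearization g X \<alpha> h) h x = inner2 g (rough_laplacian g h) h x
    - (\<Sum>k\<in>UNIV. X x $ k * partial k (inner2 g h h) x) / 2
    + potential (fr4 (riemann g) x) lam \<alpha> (fr2 h x)"
proof -
  define H where "H = fr2 h"
  define vd where "vd f = (\<Sum>k\<in>UNIV. X x $ k * partial k f x)" for f
  have smooth_H: "smooth (\<lambda>y. H y a b)" for a b
    unfolding H_def by (rule smooth_fr2[OF h])
  have "vd (inner2 g h h) = (\<Sum>k\<in>UNIV. \<Sum>a\<in>UNIV. \<Sum>b\<in>UNIV.
      2 * (X x $ k * partial k (\<lambda>y. H y a b) x * H x a b))"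
    unfolding vd_def inner2_eq[abs_def] H_def[symmetric]
    by (simp add: partial_sum partial_mult smooth_differentiable smooth_sum smooth_mult smooth_H
        sum_distrib_left algebra_simps)
  also have "\<dots> = (\<Sum>a\<in>UNIV. \<Sum>k\<in>UNIV. \<Sum>b\<in>UNIV.
      2 * (X x $ k * partial k (\<lambda>y. H y a b) x * H x a b))"
    by (rule sum.swap)
  also have "\<dots> = (\<Sum>a\<in>UNIV. \<Sum>b\<in>UNIV. \<Sum>k\<in>UNIV.
      2 * (X x $ k * partial k (\<lambda>y. H y a b) x * H x a b))"
    by (rule sum.cong[OF refl], rule sum.swap)
  also have "\<dots> = 2 * (\<Sum>a\<in>UNIV. \<Sum>b\<in>UNIV. vd (\<lambda>y. H y a b) * H x a b)"
    by (simp add: vd_def sum_distrib_left sum_distrib_right)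
  finally have vd_N: "(\<Sum>a\<in>UNIV. \<Sum>b\<in>UNIV. vd (\<lambda>y. H y a b) * H x a b) = vd (inner2 g h h) / 2"
    by simp
  have "fr2 (flow_linearization g X \<alpha> h) x a b = fr2 (rough_laplacian g h) x a b - vd (\<lambda>y. H y a b)
     + (2 * (\<Sum>c\<in>UNIV. \<Sum>d\<in>UNIV. fr4 (riemann g) x a c d b * H x c d)
     - (\<Sum>c\<in>UNIV. (\<Sum>p\<in>UNIV. fr4 (riemann g) x p a c p) * H x c b)
     - (\<Sum>c\<in>UNIV. (\<Sum>p\<in>UNIV. fr4 (riemann g) x p b c p) * H x a c)
     + (lam a + lam b - \<alpha>) * H x a b)" for a b
    unfolding fr2_flow_linearization fr2_lichnerowicz fr2_lie_deriv2[OF h X] fr2_ricci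
      vd_def H_def by (simp add: algebra_simps)
  then have "inner2 g (flow_linearization g X \<alpha> h) h x = inner2 g (rough_laplacian g h) h x
    - (\<Sum>a\<in>UNIV. \<Sum>b\<in>UNIV. vd (\<lambda>y. H y a b) * H x a b)
    + potential (fr4 (riemann g) x) lam \<alpha> (fr2 h x)"
    unfolding inner2_eq potential_def H_def[symmetric]
    by (simp only: distrib_right left_diff_distrib sum.distrib sum_subtractf)
  then show ?thesis unfolding vd_N by (simp add: vd_def)
qed

text \<open>Integrating by parts turns the transport term into \<delta>/2 times the squared norm of
  \<open>h\<close>, and the Laplacian into minus the squared norm of the derivative. What is left is
  an algebraic form with coefficients independent of the point, so \<open>bound\<close> can be
  integrated pointwise.\<close>

lemma linear_stability:
  assumes vol: "vol g = lborel"
    and X_smooth: "\<And>k. smooth (\<lambda>y. X y $ k)"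
    and X_frame: "\<And>x a i. (\<Sum>k\<in>UNIV. X x $ k * partial k (\<lambda>y. E y a i) x)
      - (\<Sum>k\<in>UNIV. E x a k * partial k (\<lambda>y. X y $ i) x) = lam a * E x a i"
    and X_div: "\<And>x. (\<Sum>k\<in>UNIV. partial k (\<lambda>y. X y $ k) x) = \<delta>"
    and Rm: "\<And>x a b c d. fr4 (riemann g) x a b c d = Rm a b c d"
    and bound: "\<And>H. (\<And>a b. H a b = H b a) \<Longrightarrow> potential Rm lam \<alpha> H
      + \<delta> / 2 * (\<Sum>a\<in>UNIV. \<Sum>b\<in>UNIV. H a b * H a b) \<le> - \<epsilon> * (\<Sum>a\<in>UNIV. \<Sum>b\<in>UNIV. H a b * H a b)"
    and h: "smooth_tensor2 h" "compactly_supported h" "symmetric_tensor2 h"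
  shows "(LINT x|vol g. inner2 g (flow_linearization g X \<alpha> h) h x)
    \<le> - (L2_norm3 g (cov_deriv2 g h))\<^sup>2 - \<epsilon> * (L2_norm2 g h)\<^sup>2"
proof -
  define K where "K = closure {x. h x \<noteq> 0}"
  have K: "compact K" using h(2) by (simp add: compactly_supported_def K_def)
  have h0: "h x = 0" if "x \<notin> K" for x using that closure_subset[of "{x. h x \<noteq> 0}"] by (auto simp: K_def)
  define A where "A = inner2 g (rough_laplacian g h) h"
  define N where "N = inner2 g h h"
  define P where "P x = potential Rm lam \<alpha> (fr2 h x)" for x
  define B where "B x = (\<Sum>k\<in>UNIV. X x $ k * partial k N x)" for x
  have N: "N = (\<lambda>x. \<Sum>a\<in>UNIV. \<Sum>b\<in>UNIV. fr2 h x a b * fr2 h x a b)"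
    unfolding N_def inner2_eq[abs_def] ..
  have H0: "fr2 h x a b = 0" if "x \<notin> K" for x a b using h0[OF that] by (simp add: fr2_def)
  have smooth_N: "smooth N" unfolding N by (intro smooth_sum smooth_mult smooth_fr2 h)
  have smooth_P: "smooth P"
    unfolding P_def[abs_def] potential_def
    by (intro smooth_sum smooth_mult smooth_add smooth_diff smooth_fr2 h smooth_const)
  have int_N: "integrable lborel N"
    by (rule integrable_compact_support[OF smooth_continuous[OF smooth_N] K]) (simp add: N H0)
  have int_P: "integrable lborel P"
    by (rule integrable_compact_support[OF smooth_continuous[OF smooth_P] K])
      (simp add: P_def potential_def H0)
  have A: "integrable lborel A" "(LINT x|lborel. A x)
      = - (LINT x|lborel. inner3 g (cov_deriv2 g h) (cov_deriv2 g h) x)"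
    unfolding A_def using integral_inner2_rough_laplacian[OF h(1) K h0] by auto
  have N0: "N x = 0" if "x \<notin> K" for x using H0[OF that] by (simp add: N)
  have B: "integrable lborel B" "(LINT x|lborel. B x) = - \<delta> * (LINT x|lborel. N x)"
    unfolding B_def using integral_by_parts[OF X_smooth smooth_N K N0] by (simp_all add: X_div)
  have "inner2 g (flow_linearization g X \<alpha> h) h x = A x - B x / 2 + P x" for x
    unfolding inner2_flow_linearization[OF h(1) X_frame] A_def B_def N_def P_def Rm[abs_def] ..
  then have "(LINT x|lborel. inner2 g (flow_linearization g X \<alpha> h) h x)
      = (LINT x|lborel. A x) + \<delta> / 2 * (LINT x|lborel. N x) + (LINT x|lborel. P x)"
    using A(1) B int_P by simp
  also have "\<dots> = (LINT x|lborel. A x) + (LINT x|lborel. P x + \<delta> / 2 * N x)"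
    using int_P int_N by simp
  also have "(LINT x|lborel. P x + \<delta> / 2 * N x) \<le> (LINT x|lborel. - \<epsilon> * N x)"
  proof (rule integral_mono)
    show "P x + \<delta> / 2 * N x \<le> - \<epsilon> * N x" for x
      unfolding P_def N by (rule bound) (rule fr2_symmetric[OF h(3)])
  qed (use int_P int_N in auto)
  also have "\<dots> = - \<epsilon> * (LINT x|lborel. N x)" by simp
  finally have "(LINT x|lborel. inner2 g (flow_linearization g X \<alpha> h) h x)
      \<le> - (LINT x|lborel. inner3 g (cov_deriv2 g h) (cov_deriv2 g h) x) - \<epsilon> * (LINT x|lborel. N x)"
    using A(2) by simp
  \<comment> \<open>The square undoes the root in the norm because the integrand is a sum of squares
    in the frame.\<close>
  moreover have "(L2_norm3 g (cov_deriv2 g h))\<^sup>2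
      = (LINT x|lborel. inner3 g (cov_deriv2 g h) (cov_deriv2 g h) x)"
    unfolding L2_norm3_def vol
    by (rule real_sqrt_pow2) (intro integral_nonneg_AE AE_I2, simp add: inner3_eq sum_nonneg)
  moreover have "(L2_norm2 g h)\<^sup>2 = (LINT x|lborel. N x)"
    unfolding L2_norm2_def vol N_def
    by (rule real_sqrt_pow2) (intro integral_nonneg_AE AE_I2, simp add: inner2_eq sum_nonneg)
  ultimately show ?thesis by (simp add: vol)
qed

end

section \<open>The metric of nil4 in coordinates\<close>

lemma vector_4 [simp]:
  "(vector [x, y, z, w] :: ('a::zero) ^ 4) $ 1 = x"
  "(vector [x, y, z, w] :: ('a::zero) ^ 4) $ 2 = y"
  "(vector [x, y, z, w] :: ('a::zero) ^ 4) $ 3 = z"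
  "(vector [x, y, z, w] :: ('a::zero) ^ 4) $ 4 = w"
  unfolding vector_def by simp_all

text \<open>Keeps the simplifier from normalizing all entries of a table before selecting one of them.\<close>

lemma vector_weak_cong: "vector l = vector l"
  by (rule refl)

definition nil4_frame :: "real ^ 4 \<Rightarrow> real ^ 4 ^ 4" where
  "nil4_frame x = vector [vector [1, 0, 0, 0],
      vector [0, 1, 0, 0],
      vector [0, 0, 1, 0],
      vector [0, x $ 1, x $ 2, 1]]"

text \<open>The sum of the e_a tensor e_a, where e_a is row \<open>a\<close> of
  \<open>nil4_frame\<close>.\<close>

definition nil4_inverse :: "real ^ 4 \<Rightarrow> real ^ 4 ^ 4" where
  "nil4_inverse x = vector [vector [1, 0, 0, 0],
      vector [0, 1 + x $ 1 * x $ 1, x $ 1 * x $ 2, x $ 1],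
      vector [0, x $ 1 * x $ 2, 1 + x $ 2 * x $ 2, x $ 2],
      vector [0, x $ 1, x $ 2, 1]]"

text \<open>The outermost index is the upper one. Polynomial closed forms make the derivatives in
  the curvature directly computable.\<close>

definition nil4_christoffel :: "real ^ 4 \<Rightarrow> real ^ 4 ^ 4 ^ 4" where
  "nil4_christoffel x = vector [
   vector [0,
      vector [0, 0, 0, 1 / 2],
      0,
      vector [0, 1 / 2, 0, - x $ 1]],
   vector [vector [0, - (x $ 1 / 2), 0, x $ 1 * x $ 1 / 2 - 1 / 2],
      vector [- (x $ 1 / 2), 0, - (x $ 1 / 2), x $ 1 * x $ 2 / 2],
      vector [0, - (x $ 1 / 2), 0, 1 / 2 + x $ 1 * x $ 1 / 2],
      vector [x $ 1 * x $ 1 / 2 - 1 / 2, x $ 1 * x $ 2 / 2, 1 / 2 + x $ 1 * x $ 1 / 2, - (x $ 1 * x $ 1 * x $ 2) - x $ 2]],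
   vector [vector [0, - (x $ 2 / 2), 0, x $ 1 * x $ 2 / 2],
      vector [- (x $ 2 / 2), 0, - (x $ 2 / 2), x $ 2 * x $ 2 / 2 - 1 / 2],
      vector [0, - (x $ 2 / 2), 0, x $ 1 * x $ 2 / 2],
      vector [x $ 1 * x $ 2 / 2, x $ 2 * x $ 2 / 2 - 1 / 2, x $ 1 * x $ 2 / 2, - (x $ 1 * x $ 2 * x $ 2)]],
   vector [vector [0, - (1 / 2), 0, x $ 1 / 2],
      vector [- (1 / 2), 0, - (1 / 2), x $ 2 / 2],
      vector [0, - (1 / 2), 0, x $ 1 / 2],
      vector [x $ 1 / 2, x $ 2 / 2, x $ 1 / 2, - (x $ 1 * x $ 2)]]]"

text \<open>Koszul's formula for the brackets [e_1, e_4] = e_2 and [e_2, e_4] = e_3, the only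
  nonzero ones up to antisymmetry.\<close>

definition nil4_connection :: "real ^ 4 ^ 4 ^ 4" where
  "nil4_connection = vector [
   vector [0,
      vector [0, 0, 0, - (1 / 2)],
      0,
      vector [0, 1 / 2, 0, 0]],
   vector [vector [0, 0, 0, - (1 / 2)],
      0,
      vector [0, 0, 0, - (1 / 2)],
      vector [1 / 2, 0, 1 / 2, 0]],
   vector [0,
      vector [0, 0, 0, - (1 / 2)],
      0,
      vector [0, 1 / 2, 0, 0]],
   vector [vector [0, - (1 / 2), 0, 0],
      vector [1 / 2, 0, - (1 / 2), 0],
      vector [0, 1 / 2, 0, 0],
      0]]"

text \<open>Four blocks suffice for the first index pair: it is antisymmetric, the pair (1,3) gives
  zero, and (3,2) gives the same block as (1,2). The two tables that follow share this
  layout.\<close>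

definition nil4_curvature_endo :: "real ^ 4 \<Rightarrow> real ^ 4 ^ 4 ^ 4 ^ 4" where
  "nil4_curvature_endo x = (let R12 = vector [vector [0, - (1 / 4), 0, 0],
      vector [1 / 4, 0, 1 / 4, 0],
      vector [0, - (1 / 4), 0, 0],
      vector [- (x $ 1 / 4), x $ 2 / 4, - (x $ 1 / 4), 0]];
    R14 = vector [vector [0, x $ 1, 3 * x $ 2 / 4, 3 / 4],
      vector [- (x $ 1 / 4), 0, - (x $ 1 / 4), 0],
      vector [0, x $ 1 / 2, x $ 2 / 4, 1 / 4],
      vector [x $ 1 * x $ 1 / 4 - 3 / 4, - (x $ 1 * x $ 2 / 2), x $ 1 * x $ 1 / 4 - 1 / 4 - x $ 2 * x $ 2 / 4, - (x $ 2 / 4)]];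
    R24 = vector [vector [0, - (x $ 2 / 4), 0, 0],
      vector [x $ 2 / 4, x $ 1 / 2, 3 * x $ 2 / 4, 1 / 2],
      vector [0, - (x $ 2 / 4), 0, 0],
      vector [- (x $ 1 * x $ 2 / 4), x $ 2 * x $ 2 / 4 - 1 / 2 - x $ 1 * x $ 1 / 2, - (3 * x $ 1 * x $ 2 / 4), - (x $ 1 / 2)]];
    R34 = vector [vector [0, x $ 1 / 2, x $ 2 / 4, 1 / 4],
      vector [- (x $ 1 / 4), 0, - (x $ 1 / 4), 0],
      vector [0, 0, - (x $ 2 / 4), - (1 / 4)],
      vector [x $ 1 * x $ 1 / 4 - 1 / 4, 0, 1 / 4 + x $ 1 * x $ 1 / 4 + x $ 2 * x $ 2 / 4, x $ 2 / 4]]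
    in vector [vector [0, R12, 0, R14], vector [- R12, 0, - R12, R24], vector [0, R12, 0, R34], vector [- R14, - R24, - R34, 0]])"

definition nil4_riemann :: "real ^ 4 \<Rightarrow> real ^ 4 ^ 4 ^ 4 ^ 4" where
  "nil4_riemann x = (let R12 = vector [vector [0, - (1 / 4), 0, x $ 1 / 4],
      vector [1 / 4, 0, 1 / 4, - (x $ 2 / 4)],
      vector [0, - (1 / 4), 0, x $ 1 / 4],
      vector [- (x $ 1 / 4), x $ 2 / 4, - (x $ 1 / 4), 0]];
    R14 = vector [vector [0, x $ 1 / 4, 0, 3 / 4 - x $ 1 * x $ 1 / 4],
      vector [- (x $ 1 / 4), 0, - (x $ 1 / 4), x $ 1 * x $ 2 / 4],
      vector [0, x $ 1 / 4, 0, 1 / 4 - x $ 1 * x $ 1 / 4],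
      vector [x $ 1 * x $ 1 / 4 - 3 / 4, - (x $ 1 * x $ 2 / 4), x $ 1 * x $ 1 / 4 - 1 / 4, 0]];
    R24 = vector [vector [0, - (x $ 2 / 4), 0, x $ 1 * x $ 2 / 4],
      vector [x $ 2 / 4, 0, x $ 2 / 4, 1 / 2 - x $ 2 * x $ 2 / 4],
      vector [0, - (x $ 2 / 4), 0, x $ 1 * x $ 2 / 4],
      vector [- (x $ 1 * x $ 2 / 4), x $ 2 * x $ 2 / 4 - 1 / 2, - (x $ 1 * x $ 2 / 4), 0]];
    R34 = vector [vector [0, x $ 1 / 4, 0, 1 / 4 - x $ 1 * x $ 1 / 4],
      vector [- (x $ 1 / 4), 0, - (x $ 1 / 4), x $ 1 * x $ 2 / 4],
      vector [0, x $ 1 / 4, 0, - (1 / 4) - x $ 1 * x $ 1 / 4],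
      vector [x $ 1 * x $ 1 / 4 - 1 / 4, - (x $ 1 * x $ 2 / 4), 1 / 4 + x $ 1 * x $ 1 / 4, 0]]
    in vector [vector [0, R12, 0, R14], vector [- R12, 0, - R12, R24], vector [0, R12, 0, R34], vector [- R14, - R24, - R34, 0]])"

text \<open>The values of \<open>nil4_riemann\<close> at the origin, where the frame is the
  coordinate frame. Constant structure coefficients of the frame give the same values at every
  point.\<close>

definition nil4_frame_curvature :: "real ^ 4 ^ 4 ^ 4 ^ 4" where
  "nil4_frame_curvature = (let R12 = vector [vector [0, - (1 / 4), 0, 0],
      vector [1 / 4, 0, 1 / 4, 0],
      vector [0, - (1 / 4), 0, 0],
      0];
    R14 = vector [vector [0, 0, 0, 3 / 4],
      0,
      vector [0, 0, 0, 1 / 4],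
      vector [- (3 / 4), 0, - (1 / 4), 0]];
    R24 = vector [0,
      vector [0, 0, 0, 1 / 2],
      0,
      vector [0, - (1 / 2), 0, 0]];
    R34 = vector [vector [0, 0, 0, 1 / 4],
      0,
      vector [0, 0, 0, - (1 / 4)],
      vector [- (1 / 4), 0, 1 / 4, 0]]
    in vector [vector [0, R12, 0, R14], vector [- R12, 0, - R12, R24], vector [0, R12, 0, R34], vector [- R14, - R24, - R34, 0]])"

section \<open>Checking the tables against the definitions\<close>

lemma nil4_metric_eq: "nil4_metric x = vector [vector [1, 0, 0, 0],
      vector [0, 1, 0, - x $ 1],
      vector [0, 0, 1, - x $ 2],
      vector [0, - x $ 1, - x $ 2, 1 + x $ 1 * x $ 1 + x $ 2 * x $ 2]]"
  unfolding vec_eq_iff forall_4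
  by (simp add: nil4_metric_def tensor_prod_def nil4_coframe_def sum_4 axis_def power2_eq_square)

lemma nil4_metric_inverse:
  "nil4_metric x ** nil4_inverse x = mat 1" "nil4_inverse x ** nil4_metric x = mat 1"
  unfolding vec_eq_iff forall_4 nil4_metric_eq nil4_inverse_def
  by (simp_all add: matrix_matrix_mult_def mat_def sum_4 algebra_simps)

lemma ginv_nil4: "ginv nil4_metric x i j = nil4_inverse x $ i $ j"
proof -
  have "matrix_inv (nil4_metric x) = nil4_inverse x"
    unfolding matrix_inv_def
  proof (rule some_equality)
    fix B assume B: "nil4_metric x ** B = mat 1 \<and> B ** nil4_metric x = mat 1"
    have "B = B ** (nil4_metric x ** nil4_inverse x)" by (simp add: nil4_metric_inverse)
    also have "\<dots> = nil4_inverse x" using B by (simp add: matrix_mul_assoc)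
    finally show "B = nil4_inverse x" .
  qed (simp add: nil4_metric_inverse)
  then show ?thesis by (simp add: ginv_def)
qed

lemma det_nil4: "det (nil4_metric x) = 1"
proof -
  \<comment> \<open>In the type \<open>4\<close> the numeral 4 equals 0 and is the least element.
    The entries of column 4 therefore count as lying below the diagonal, and the coframe is lower
    triangular with unit diagonal.\<close>
  have less: "\<not> 1 < (4::4)" "\<not> 2 < (4::4)" "\<not> 3 < (4::4)"
    by (simp_all add: less_bit0_def bit0.Rep_numeral bit0.Rep_1)
  have "det (nil4_coframe x) = (\<Prod>i\<in>UNIV. nil4_coframe x $ i $ i)"
  proof (rule det_lowerdiagonal)
    have "\<forall>i j. i < j \<longrightarrow> nil4_coframe x $ i $ j = 0"
      unfolding forall_4 using less by (simp add: nil4_coframe_def axis_def)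
    then show "i < j \<Longrightarrow> nil4_coframe x $ i $ j = 0" for i j by blast
  qed
  also have "\<dots> = 1" unfolding UNIV_4 by (simp add: nil4_coframe_def axis_def)
  finally have "det (transpose (nil4_coframe x) ** nil4_coframe x) = 1"
    by (simp add: det_mul det_transpose)
  moreover have "nil4_metric x = transpose (nil4_coframe x) ** nil4_coframe x"
    by (simp add: vec_eq_iff nil4_metric_def tensor_prod_def matrix_matrix_mult_def transpose_def)
  ultimately show ?thesis by simp
qed

lemma vol_nil4: "vol nil4_metric = lborel"
  by (simp add: vol_def det_nil4 density_1)

text \<open>The differentiation rules come with smoothness closure rules, so that simplification
  discharges their differentiability premises.\<close>

lemmas partial_calculus =
  partial_add[OF smooth_differentiable smooth_differentiable]
  partial_diff[OF smooth_differentiable smooth_differentiable]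
  partial_mult[OF smooth_differentiable smooth_differentiable]
  partial_minus[OF smooth_differentiable]
  partial_divide[OF smooth_differentiable]
  smooth_add smooth_diff smooth_mult smooth_minus smooth_divide

lemma christoffel_nil4: "christoffel nil4_metric x k i j = nil4_christoffel x $ k $ i $ j"
proof -
  \<comment> \<open>Quantified over all indices, the identity becomes a finite conjunction by
    \<open>forall_4\<close>, one polynomial identity for each index triple. The same device is used
    for the curvature tables.\<close>
  have "\<forall>k i j. christoffel nil4_metric x k i j = nil4_christoffel x $ k $ i $ j"
    unfolding forall_4 christoffel_def sum_4 nil4_metric_eq ginv_nil4
    by (intro conjI; simp add: nil4_inverse_def nil4_christoffel_def partial_calculus field_simps
        cong: vector_weak_cong)
  then show ?thesis by blast
qed

lemma curvature_endo_nil4: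
  "curvature_endo nil4_metric x i j k l = nil4_curvature_endo x $ i $ j $ k $ l"
proof -
  have "\<forall>i j k l. curvature_endo nil4_metric x i j k l = nil4_curvature_endo x $ i $ j $ k $ l"
    unfolding forall_4 curvature_endo_def sum_4 christoffel_nil4
    by (intro conjI; simp add: nil4_christoffel_def nil4_curvature_endo_def Let_def partial_calculus field_simps
        cong: vector_weak_cong)
  then show ?thesis by blast
qed

lemma riemann_nil4: "riemann nil4_metric x i j k l = nil4_riemann x $ i $ j $ k $ l"
proof -
  have "\<forall>i j k l. riemann nil4_metric x i j k l = nil4_riemann x $ i $ j $ k $ l"
    unfolding forall_4 riemann_def sum_4 curvature_endo_nil4 nil4_metric_eq
    by (intro conjI; simp add: nil4_curvature_endo_def nil4_riemann_def Let_def field_simps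
        cong: vector_weak_cong)
  then show ?thesis by blast
qed

section \<open>Stability\<close>

text \<open>The frame spans a nilpotent Lie algebra, whence the constant coefficients. Nilpotent
  groups are unimodular, which is the reason for both trace conditions \<open>E_div\<close> and
  \<open>\<omega>_trace\<close>.\<close>

interpretation nil4: orthonormal_frame nil4_metric "\<lambda>x a i. nil4_frame x $ a $ i"
  "\<lambda>c a d. nil4_connection $ c $ a $ d"
proof
  have frame: "\<forall>a i. smooth (\<lambda>y. nil4_frame y $ a $ i)"
    unfolding forall_4 by (simp add: nil4_frame_def)
  then show "smooth (\<lambda>y. nil4_frame y $ a $ i)" for a i by blast
  have "\<forall>k i j. smooth (\<lambda>y. christoffel nil4_metric y k i j)"
    unfolding forall_4 christoffel_nil4
    by (intro conjI; simp add: nil4_christoffel_def partial_calculus cong: vector_weak_cong)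
  then show "smooth (\<lambda>y. christoffel nil4_metric y k i j)" for k i j by blast
  have "\<forall>i j. ginv nil4_metric x i j = (\<Sum>a\<in>UNIV. nil4_frame x $ a $ i * nil4_frame x $ a $ j)" for x
    unfolding forall_4 ginv_nil4 sum_4 by (simp add: nil4_inverse_def nil4_frame_def)
  then show "ginv nil4_metric x i j = (\<Sum>a\<in>UNIV. nil4_frame x $ a $ i * nil4_frame x $ a $ j)" for x i j
    by blast
  have "\<forall>c a i. (\<Sum>k\<in>UNIV. nil4_frame x $ c $ k * (partial k (\<lambda>y. nil4_frame y $ a $ i) x
      + (\<Sum>m\<in>UNIV. christoffel nil4_metric x i k m * nil4_frame x $ a $ m)))
    = (\<Sum>d\<in>UNIV. nil4_connection $ c $ a $ d * nil4_frame x $ d $ i)" for x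
    unfolding forall_4 christoffel_nil4 sum_4
    by (intro conjI; simp add: nil4_christoffel_def nil4_connection_def nil4_frame_def
        field_simps cong: vector_weak_cong)
  then show "(\<Sum>k\<in>UNIV. nil4_frame x $ c $ k * (partial k (\<lambda>y. nil4_frame y $ a $ i) x
      + (\<Sum>m\<in>UNIV. christoffel nil4_metric x i k m * nil4_frame x $ a $ m)))
    = (\<Sum>d\<in>UNIV. nil4_connection $ c $ a $ d * nil4_frame x $ d $ i)" for x c a i by blast
  have "\<forall>c a d. nil4_connection $ c $ a $ d = - nil4_connection $ c $ d $ a"
    unfolding forall_4 by (intro conjI; simp add: nil4_connection_def cong: vector_weak_cong)
  then show "nil4_connection $ c $ a $ d = - nil4_connection $ c $ d $ a" for c a d by blast
  have "\<forall>c. (\<Sum>k\<in>UNIV. partial k (\<lambda>y. nil4_frame y $ c $ k) x) = 0" for x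
    unfolding forall_4 sum_4 by (simp add: nil4_frame_def)
  then show "(\<Sum>k\<in>UNIV. partial k (\<lambda>y. nil4_frame y $ c $ k) x) = 0" for x c by blast
  have "\<forall>d. (\<Sum>c\<in>UNIV. nil4_connection $ c $ c $ d) = 0"
    unfolding forall_4 sum_4 by (simp add: nil4_connection_def cong: vector_weak_cong)
  then show "(\<Sum>c\<in>UNIV. nil4_connection $ c $ c $ d) = 0" for d by blast
qed

lemma nil4_fr:
  "nil4.fr x 1 u = u 1" "nil4.fr x 2 u = u 2" "nil4.fr x 3 u = u 3"
  "nil4.fr x 4 u = x $ 1 * u 2 + x $ 2 * u 3 + u 4"
  unfolding nil4.fr_def sum_4 by (simp_all add: nil4_frame_def)

lemma nil4_fr4_riemann:
  "nil4.fr4 (riemann nil4_metric) x a b c d = nil4_frame_curvature $ a $ b $ c $ d"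
proof -
  have "\<forall>a b c d. nil4.fr4 (riemann nil4_metric) x a b c d = nil4_frame_curvature $ a $ b $ c $ d"
    unfolding forall_4 nil4.fr4_def nil4_fr riemann_nil4
    by (intro conjI; simp add: nil4_riemann_def nil4_frame_curvature_def Let_def field_simps
        cong: vector_weak_cong)
  then show ?thesis by blast
qed

text \<open>The eigenvalues \<open>\<lambda>\<^sub>a\<close> in \<open>\<L>\<^sub>X e\<^sub>a = \<lambda>\<^sub>a e\<^sub>a\<close>.\<close>

definition nil4_weights :: "real ^ 4" where
  "nil4_weights = vector [2, 3, 4, 1]"

lemma nil4_field_frame:
  "(\<Sum>k\<in>UNIV. nil4_field x $ k * partial k (\<lambda>y. nil4_frame y $ a $ i) x)
    - (\<Sum>k\<in>UNIV. nil4_frame x $ a $ k * partial k (\<lambda>y. nil4_field y $ i) x)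
    = nil4_weights $ a * nil4_frame x $ a $ i"
proof -
  have "\<forall>a i. (\<Sum>k\<in>UNIV. nil4_field x $ k * partial k (\<lambda>y. nil4_frame y $ a $ i) x)
    - (\<Sum>k\<in>UNIV. nil4_frame x $ a $ k * partial k (\<lambda>y. nil4_field y $ i) x)
    = nil4_weights $ a * nil4_frame x $ a $ i"
    unfolding forall_4 sum_4
    by (simp add: nil4_field_def nil4_frame_def nil4_weights_def partial_calculus)
  then show ?thesis by blast
qed

text \<open>Symmetry leaves ten components, and the form splits without cross terms into
  \<open>Q1\<close>, in the diagonal entries and \<open>H 1 3\<close>, and \<open>Q2\<close>, in the
  other five. Each is bounded by completing squares. The summand with \<open>(- 10) / 2\<close> is
  half the divergence of the soliton field.\<close>

lemma nil4_potential_bound: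
  fixes H :: "4 \<Rightarrow> 4 \<Rightarrow> real"
  assumes sym: "\<And>a b. H a b = H b a"
  shows "nil4.potential (\<lambda>a b c d. nil4_frame_curvature $ a $ b $ c $ d) (($) nil4_weights) 3 H
      + (- 10) / 2 * (\<Sum>a\<in>UNIV. \<Sum>b\<in>UNIV. H a b * H a b)
    \<le> - (1 / 5) * (\<Sum>a\<in>UNIV. \<Sum>b\<in>UNIV. H a b * H a b)"
proof -
  have sym': "H 2 1 = H 1 2" "H 3 1 = H 1 3" "H 4 1 = H 1 4" "H 3 2 = H 2 3" "H 4 2 = H 2 4" "H 4 3 = H 3 4"
    by (rule sym)+
  define a b c d u where "a = H 1 1" and "b = H 2 2" and "c = H 3 3" and "d = H 4 4" and "u = H 1 3"
  define p q r s t where "p = H 1 2" and "q = H 2 3" and "r = H 1 4" and "s = H 3 4" and "t = H 2 4"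
  note H_defs = a_def b_def c_def d_def u_def p_def q_def r_def s_def t_def
  define Q1 where "Q1 = - 3 * a\<^sup>2 - 2 * b\<^sup>2 - c\<^sup>2 - 4 * d\<^sup>2 - 4 * u\<^sup>2
    + a * b - 3 * a * d + b * c - 2 * b * d + c * d + 2 * u * b - 2 * u * d"
  define Q2 where "Q2 = - 6 * p\<^sup>2 - 2 * p * q - 4 * q\<^sup>2 - 4 * r\<^sup>2 + 2 * r * s - 6 * s\<^sup>2 - 4 * t\<^sup>2"
  define n1 where "n1 = a\<^sup>2 + b\<^sup>2 + c\<^sup>2 + d\<^sup>2 + 2 * u\<^sup>2"
  define n2 where "n2 = p\<^sup>2 + q\<^sup>2 + r\<^sup>2 + s\<^sup>2 + t\<^sup>2"
  have "nil4.potential (\<lambda>a b c d. nil4_frame_curvature $ a $ b $ c $ d) (($) nil4_weights) 3 H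
      + (- 10) / 2 * (\<Sum>a\<in>UNIV. \<Sum>b\<in>UNIV. H a b * H a b) = Q1 + Q2"
    unfolding nil4.potential_def sum_4 sym' Q1_def Q2_def H_defs
    by (simp add: nil4_frame_curvature_def Let_def nil4_weights_def power2_eq_square field_simps
        cong: vector_weak_cong)
  moreover have "Q1 \<le> - (1 / 5) * n1"
  proof -
    \<comment> \<open>The first three squares absorb all cross terms with \<open>u\<close>,
      \<open>a\<close> and \<open>c\<close> in turn; the fourth takes the one left between
      \<open>b\<close> and \<open>d\<close>. The remaining coefficients stay positive, the tightest
      being 1/80 for \<open>b\<close>.\<close>
    have "- (1 / 5) * n1 - Q1
      = 18 / 5 * (u - 5 / 18 * (b - d))\<^sup>2 + 2 * (a + 3 / 4 * d - b / 4)\<^sup>2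
        + 4 / 5 * (c - 5 / 8 * (b + d))\<^sup>2 + 193 / 180 * (b + 5 / 4 * d)\<^sup>2
        + 4 / 5 * a\<^sup>2 + 1 / 80 * b\<^sup>2 + 131 / 320 * d\<^sup>2"
      unfolding n1_def Q1_def by (simp add: power2_eq_square field_simps)
    also have "\<dots> \<ge> 0" by simp
    finally show ?thesis by simp
  qed
  \<comment> \<open>Off-diagonal components count twice in the squared norm, which is
    \<open>n1 + 2 * n2\<close>, so the rate 1/5 becomes 2/5 here.\<close>
  moreover have "Q2 \<le> - (2 / 5) * n2"
  proof -
    have "- (2 / 5) * n2 - Q2
      = (p + q)\<^sup>2 + 23 / 5 * p\<^sup>2 + 13 / 5 * q\<^sup>2 + (r - s)\<^sup>2 + 13 / 5 * r\<^sup>2 + 23 / 5 * s\<^sup>2 + 18 / 5 * t\<^sup>2"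
      unfolding n2_def Q2_def by (simp add: power2_eq_square field_simps)
    also have "\<dots> \<ge> 0" by simp
    finally show ?thesis by simp
  qed
  moreover have "(\<Sum>a\<in>UNIV. \<Sum>b\<in>UNIV. H a b * H a b) = n1 + 2 * n2"
    unfolding sum_4 sym' n1_def n2_def H_defs by (simp add: power2_eq_square)
  ultimately show ?thesis by (simp add: add_divide_distrib)
qed

theorem proposition8:
  shows "\<exists>\<omega>::real. \<omega> > 0.0057 \<and>
    (\<forall>h :: 4 tensor2_field.
       smooth_tensor2 h \<and> compactly_supported h \<and> symmetric_tensor2 h \<longrightarrow>
       (LINT x|vol nil4_metric.
          inner2 nil4_metric (flow_linearization nil4_metric nil4_field 3 h) h x)
       \<le> - (L2_norm3 nil4_metric (cov_deriv2 nil4_metric h))\<^sup>2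
          - \<omega> * (L2_norm2 nil4_metric h)\<^sup>2)"
proof (intro exI[of _ "1 / 5"] conjI allI impI)
  have X_smooth: "smooth (\<lambda>y. nil4_field y $ k)" for k
  proof -
    have "\<forall>k. smooth (\<lambda>y. nil4_field y $ k)"
      unfolding forall_4 by (simp add: nil4_field_def partial_calculus)
    then show ?thesis by blast
  qed
  \<comment> \<open>The divergence -2 - 3 - 4 - 1 supplies the value of \<delta>; the witness 1/5 is
    the rate from \<open>nil4_potential_bound\<close>.\<close>
  have X_div: "(\<Sum>k\<in>UNIV. partial k (\<lambda>y. nil4_field y $ k) x) = - 10" for x
    by (simp add: sum_4 nil4_field_def partial_calculus)
  show "(LINT x|vol nil4_metric.
          inner2 nil4_metric (flow_linearization nil4_metric nil4_field 3 h) h x)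
       \<le> - (L2_norm3 nil4_metric (cov_deriv2 nil4_metric h))\<^sup>2
          - 1 / 5 * (L2_norm2 nil4_metric h)\<^sup>2"
    if "smooth_tensor2 h \<and> compactly_supported h \<and> symmetric_tensor2 h" for h
    using nil4.linear_stability[OF vol_nil4 X_smooth nil4_field_frame X_div nil4_fr4_riemann
        nil4_potential_bound] that by simp
qed simp

end
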